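(* Consider the multi-agent system with leader $\dot x_0=A_0x_0+B_0u_0$ and followers $\dot x_i=A_ix_i+B_iu_i$, $i=1,\dots,N$, where $A_i\in\mathbb{R}^{n\times n}$, $B_i\in\mathbb{R}^{n\times m}$, $x_i\in\mathbb{R}^n$, $u_i\in\mathbb{R}^m$ for $i=0,\dots,N$. Let the communication graph (with matrix weights $W_{ij}\in\mathbb{R}^{n\times n}$, not necessarily symmetric) contain a directed spanning tree rooted at the leader $0$, in which follower $i$ has the unique parent $k_i$, with $k_i<i$. Put $D_i=W_{i0}$ (so $D_i\ne0$ if and only if the leader communicates directly with follower $i$; in particular $W_{i,k_i}=D_i$ if $k_i=0$). Let the followers use the control protocol $$u_i=-G_ix_i+K_iW_{i,k_i}(x_{k_i}-x_i),\qquad i=1,\dots,N,$$ with gain matrices $G_i,K_i\in\mathbb{R}^{m\times n}$. Set $$A_i^*=A_i-B_iG_i,\qquad B_i^*=B_iK_i\,(W_{i,k_i}+D_i),\qquad i=1,\dots,N.$$ Then the leader-following state consensus is achieved if and only if the matrices $A_i^*-B_i^*$, $i=1,\dots,N$, and the matrix $L_1\bar DL_3$ (constructed in the context) are Hurwitz stable.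
   Context: **Communication graph.** A directed graph on $V=\{0,1,\dots,N\}$ with edge set $E$; $(j,i)\in E$ means that information passes from agent $j$ to agent $i$. The weight matrices satisfy $W_{ij}\neq0$ if and only if $(j,i)\in E$. No edge enters the leader $0$. A directed spanning tree rooted at $0$ is fixed, and agents are labelled so that the parent $k_i$ of follower $i$ satisfies $k_i<i$. **Leader input.** $u_0$ is the external input of the leader, treated as constant in time ($\dot u_0=0$). **Consensus.** Leader-following state consensus is achieved if the closed-loop system satisfies $\lim_{t\to\infty}\|x_i(t)-x_0(t)\|=0$ for all $i\in\{1,\dots,N\}$ (for all initial states and all such $u_0$). **Hurwitz.** A square matrix is Hurwitz stable if all its eigenvalues have negative real part. **The matrix $L_1\bar DL_3$.** Let $\hat A\in\mathbb{R}^{Nn\times n}$ be the block column whose first $n\times n$ block is $A_0-A_1+B_1G_1$ and whose $i$-th block, for $2\le i\le N$, is $A_{i-1}-B_{i-1}G_{i-1}-A_i+B_iG_i$. Let $\hat B\in\mathbb{R}^{Nn\times m}$ be the block column whose first $n\times m$ block is $B_0$ and whose other blocks are $0$. Put $$\bar B=[\hat A\ \ \hat B]\in\mathbb{R}^{Nn\times(n+m)},\qquad \bar D=\begin{bmatrix}A_0&B_0\\0&0\end{bmatrix}\in\mathbb{R}^{(n+m)\times(n+m)},$$ and $V_k=[\bar B^T\ (\bar B\bar D)^T\ \cdots\ (\bar B\bar D^k)^T]^T$. 1. Let $s=\min\{k:\operatorname{rank}V_k=\operatorname{rank}V_{k+1}\}$ and $h=\operatorname{rank}V_s$. 2. Going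 through the rows of $V_s$ from the top, keep the first row if it is nonzero, and remove every later row that is linearly dependent on the previously kept rows; the kept rows form $L_1\in\mathbb{R}^{h\times(n+m)}$. 3. Choose $h$ linearly independent columns of $L_1$, with indices $i_1,\dots,i_h$; they form an invertible matrix $L_2\in\mathbb{R}^{h\times h}$. 4. $L_3\in\mathbb{R}^{(n+m)\times h}$ is the matrix whose row $i_j$ is row $j$ of $L_2^{-1}$ for $j=1,\dots,h$, and whose other rows are zero.
   Formalization: In B_i^*, the sum W_{i,k_i}+D_i is read as counting only follower i's single tree link, so B_i^*=B_iK_iW_{i,k_i}; with D_i=W_{i0} literally, the leader link is counted twice if k_i=0 (or an unused link is added) and the claim is false. *)

theory Defs
  imports
    Complex_Main
    "Jordan_Normal_Form.Char_Poly"
    "Jordan_Normal_Form.Gauss_Jordan_Elimination"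
    "Jordan_Normal_Form.DL_Rank"
begin

text \<open>Communication graph. A pair \<open>(j, i)\<close> in \<open>E\<close> is a link carrying information from \<open>j\<close> to
  \<open>i\<close>, so its weight is \<open>W i j\<close>.\<close>

definition communication_graph ::
  "nat \<Rightarrow> nat \<Rightarrow> (nat \<times> nat) set \<Rightarrow> (nat \<Rightarrow> nat \<Rightarrow> real mat) \<Rightarrow> bool" where
  "communication_graph N n E W \<longleftrightarrow>
     E \<subseteq> {0..N} \<times> {0..N} \<and>
     (\<forall>j. (j, 0) \<notin> E) \<and>
     (\<forall>i\<le>N. \<forall>j\<le>N. W i j \<in> carrier_mat n n \<and> (W i j \<noteq> 0\<^sub>m n n \<longleftrightarrow> (j, i) \<in> E))"

definition directed_spanning_tree ::
  "nat \<Rightarrow> (nat \<times> nat) set \<Rightarrow> (nat \<times> nat) set \<Rightarrow> nat \<Rightarrow> bool" where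
  "directed_spanning_tree N E T r \<longleftrightarrow>
     T \<subseteq> E \<and> r \<le> N \<and>
     (\<forall>j. (j, r) \<notin> T) \<and>
     (\<forall>i\<le>N. i \<noteq> r \<longrightarrow> (\<exists>!j. (j, i) \<in> T)) \<and>
     (\<forall>i\<le>N. (r, i) \<in> T\<^sup>*)"


definition vnorm :: "real vec \<Rightarrow> real" where
  "vnorm v = sqrt (scalar_prod v v)"

text \<open>The time domain is \<open>{0..}\<close>; the derivative at \<open>0\<close> is one-sided.\<close>

definition has_vec_derivative ::
  "nat \<Rightarrow> (real \<Rightarrow> real vec) \<Rightarrow> real vec \<Rightarrow> real \<Rightarrow> bool" where
  "has_vec_derivative n f v t \<longleftrightarrow>
     (\<forall>a<n. ((\<lambda>\<tau>. f \<tau> $ a) has_real_derivative v $ a) (at t within {0..}))"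

definition closed_loop_trajectory ::
  "nat \<Rightarrow> nat \<Rightarrow> nat \<Rightarrow> (nat \<Rightarrow> real mat) \<Rightarrow> (nat \<Rightarrow> real mat) \<Rightarrow> (nat \<Rightarrow> real mat) \<Rightarrow>
   (nat \<Rightarrow> real mat) \<Rightarrow> (nat \<Rightarrow> nat \<Rightarrow> real mat) \<Rightarrow> (nat \<Rightarrow> nat) \<Rightarrow> real vec \<Rightarrow>
   (nat \<Rightarrow> real \<Rightarrow> real vec) \<Rightarrow> (nat \<Rightarrow> real \<Rightarrow> real vec) \<Rightarrow> bool" where
  "closed_loop_trajectory N n m A B G K W k u\<^sub>0 x u \<longleftrightarrow>
     (\<forall>i\<le>N. \<forall>t\<ge>0. x i t \<in> carrier_vec n \<and> u i t \<in> carrier_vec m) \<and>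
     (\<forall>i\<le>N. \<forall>t\<ge>0. has_vec_derivative n (x i) (A i *\<^sub>v x i t + B i *\<^sub>v u i t) t) \<and>
     (\<forall>t\<ge>0. u 0 t = u\<^sub>0) \<and>
     (\<forall>i\<in>{1..N}. \<forall>t\<ge>0.
        u i t = - (G i *\<^sub>v x i t) + (K i * W i (k i)) *\<^sub>v (x (k i) t - x i t))"

text \<open>Quantifying over all trajectories quantifies over all initial states \<open>x i 0\<close>, since the
  closed loop is a linear ODE with constant coefficients.\<close>

definition leader_following_consensus ::
  "nat \<Rightarrow> nat \<Rightarrow> nat \<Rightarrow> (nat \<Rightarrow> real mat) \<Rightarrow> (nat \<Rightarrow> real mat) \<Rightarrow> (nat \<Rightarrow> real mat) \<Rightarrow>
   (nat \<Rightarrow> real mat) \<Rightarrow> (nat \<Rightarrow> nat \<Rightarrow> real mat) \<Rightarrow> (nat \<Rightarrow> nat) \<Rightarrow> bool" where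
  "leader_following_consensus N n m A B G K W k \<longleftrightarrow>
     (\<forall>u\<^sub>0\<in>carrier_vec m. \<forall>x u. closed_loop_trajectory N n m A B G K W k u\<^sub>0 x u \<longrightarrow>
        (\<forall>i\<in>{1..N}. ((\<lambda>t. vnorm (x i t - x 0 t)) \<longlongrightarrow> 0) at_top))"

definition hurwitz :: "real mat \<Rightarrow> bool" where
  "hurwitz M \<longleftrightarrow> square_mat M \<and> (\<forall>z. eigenvalue (map_mat complex_of_real M) z \<longrightarrow> Re z < 0)"


definition A_star :: "(nat \<Rightarrow> real mat) \<Rightarrow> (nat \<Rightarrow> real mat) \<Rightarrow> (nat \<Rightarrow> real mat) \<Rightarrow> nat \<Rightarrow> real mat" where
  "A_star A B G i = A i - B i * G i"

text \<open>The two summands of \<open>W\<^bsub>i,k i\<^esub> + D\<^sub>i\<close> are the weight of the tree link from a follower parent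
  and the weight \<open>W\<^bsub>i,0\<^esub>\<close> of the tree link from the leader; the one that is absent is zero.
  Follower \<open>i\<close> receives information along a single tree link, hence exactly one of them is
  present. Adding the entries \<open>W i (k i)\<close> and \<open>W i 0\<close> themselves would count the leader's link
  twice when \<open>k i = 0\<close>, and would otherwise include a link that the protocol does not use.\<close>

definition follower_weight :: "nat \<Rightarrow> (nat \<Rightarrow> nat \<Rightarrow> real mat) \<Rightarrow> (nat \<Rightarrow> nat) \<Rightarrow> nat \<Rightarrow> real mat" where
  "follower_weight n W k i = (if k i = 0 then 0\<^sub>m n n else W i (k i))"

definition leader_weight :: "nat \<Rightarrow> (nat \<Rightarrow> nat \<Rightarrow> real mat) \<Rightarrow> (nat \<Rightarrow> nat) \<Rightarrow> nat \<Rightarrow> real mat" where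
  "leader_weight n W k i = (if k i = 0 then W i 0 else 0\<^sub>m n n)"

definition B_star ::
  "nat \<Rightarrow> (nat \<Rightarrow> real mat) \<Rightarrow> (nat \<Rightarrow> real mat) \<Rightarrow> (nat \<Rightarrow> nat \<Rightarrow> real mat) \<Rightarrow> (nat \<Rightarrow> nat) \<Rightarrow>
   nat \<Rightarrow> real mat" where
  "B_star n B K W k i = B i * K i * (follower_weight n W k i + leader_weight n W k i)"


definition A_hat_block ::
  "(nat \<Rightarrow> real mat) \<Rightarrow> (nat \<Rightarrow> real mat) \<Rightarrow> (nat \<Rightarrow> real mat) \<Rightarrow> nat \<Rightarrow> real mat" where
  "A_hat_block A B G i =
     (if i = 1 then A 0 - A 1 + B 1 * G 1
      else A (i - 1) - B (i - 1) * G (i - 1) - A i + B i * G i)"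

text \<open>Row \<open>r\<close> lies in the block numbered \<open>r div n + 1\<close>.\<close>

definition A_hat ::
  "nat \<Rightarrow> nat \<Rightarrow> (nat \<Rightarrow> real mat) \<Rightarrow> (nat \<Rightarrow> real mat) \<Rightarrow> (nat \<Rightarrow> real mat) \<Rightarrow> real mat" where
  "A_hat N n A B G = mat (N * n) n (\<lambda>(r, c). A_hat_block A B G (r div n + 1) $$ (r mod n, c))"

definition B_hat :: "nat \<Rightarrow> nat \<Rightarrow> nat \<Rightarrow> (nat \<Rightarrow> real mat) \<Rightarrow> real mat" where
  "B_hat N n m B = mat (N * n) m (\<lambda>(r, c). if r < n then B 0 $$ (r, c) else 0)"

definition B_bar ::
  "nat \<Rightarrow> nat \<Rightarrow> nat \<Rightarrow> (nat \<Rightarrow> real mat) \<Rightarrow> (nat \<Rightarrow> real mat) \<Rightarrow> (nat \<Rightarrow> real mat) \<Rightarrow> real mat" where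
  "B_bar N n m A B G = mat (N * n) (n + m)
     (\<lambda>(r, c). if c < n then A_hat N n A B G $$ (r, c) else B_hat N n m B $$ (r, c - n))"

definition D_bar :: "nat \<Rightarrow> nat \<Rightarrow> (nat \<Rightarrow> real mat) \<Rightarrow> (nat \<Rightarrow> real mat) \<Rightarrow> real mat" where
  "D_bar n m A B = four_block_mat (A 0) (B 0) (0\<^sub>m m n) (0\<^sub>m m m)"

fun V_mat :: "real mat \<Rightarrow> real mat \<Rightarrow> nat \<Rightarrow> real mat" where
  "V_mat Bb Db 0 = Bb"
| "V_mat Bb Db (Suc k) = V_mat Bb Db k @\<^sub>r (Bb * (Db ^\<^sub>m Suc k))"

definition mat_rank :: "real mat \<Rightarrow> nat" where
  "mat_rank M = vec_space.rank (dim_row M) M"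

definition s_index :: "real mat \<Rightarrow> real mat \<Rightarrow> nat" where
  "s_index Bb Db = (LEAST k. mat_rank (V_mat Bb Db k) = mat_rank (V_mat Bb Db (Suc k)))"

definition h_rank :: "real mat \<Rightarrow> real mat \<Rightarrow> nat" where
  "h_rank Bb Db = mat_rank (V_mat Bb Db (s_index Bb Db))"

abbreviation vec_span :: "nat \<Rightarrow> real vec set \<Rightarrow> real vec set" where
  "vec_span d \<equiv> LinearCombinations.module.span class_ring (module_vec TYPE(real) d)"

abbreviation vec_lin_dep :: "nat \<Rightarrow> real vec set \<Rightarrow> bool" where
  "vec_lin_dep d \<equiv> LinearCombinations.module.lin_dep class_ring (module_vec TYPE(real) d)"

text \<open>While nothing has been kept, the span is the zero space, so precisely the zero rows are
  dropped.\<close>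

fun keep_rows :: "nat \<Rightarrow> real vec list \<Rightarrow> real vec list \<Rightarrow> real vec list" where
  "keep_rows d kept [] = kept"
| "keep_rows d kept (r # rs) =
     keep_rows d (if r \<in> vec_span d (set kept) then kept else kept @ [r]) rs"

definition L1_mat :: "real mat \<Rightarrow> real mat \<Rightarrow> real mat" where
  "L1_mat Bb Db =
     mat_of_rows (dim_col Bb) (keep_rows (dim_col Bb) [] (rows (V_mat Bb Db (s_index Bb Db))))"

text \<open>The list \<open>cs\<close> holds the chosen column indices (counted from 0).\<close>

definition independent_columns :: "nat \<Rightarrow> real mat \<Rightarrow> nat list \<Rightarrow> bool" where
  "independent_columns h L cs \<longleftrightarrow>
     length cs = h \<and> set cs \<subseteq> {..<dim_col L} \<and>
     distinct (map (col L) cs) \<and> \<not> vec_lin_dep (dim_row L) (set (map (col L) cs))"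

definition L2_mat :: "real mat \<Rightarrow> nat list \<Rightarrow> real mat" where
  "L2_mat L cs = mat_of_cols (dim_row L) (map (col L) cs)"

definition L3_mat :: "real mat \<Rightarrow> nat list \<Rightarrow> real mat" where
  "L3_mat L cs = mat (dim_col L) (length cs) (\<lambda>(r, c).
     if r \<in> set cs
     then the (mat_inverse (L2_mat L cs)) $$ ((THE j. j < length cs \<and> cs ! j = r), c)
     else 0)"

end

theory Submission
  imports Defs "Jordan_Normal_Form.Schur_Decomposition" "Jordan_Normal_Form.Matrix_Kernel"
begin

text \<open>Relative to the leader, the error of follower \<open>i\<close> obeys
  \<open>e\<^sub>i' = (A\<^sub>i\<^sup>* - B\<^sub>i\<^sup>*) e\<^sub>i + B\<^sub>i\<^sup>* e\<^bsub>k i\<^esub> - w\<^sub>i\<close> with \<open>w\<^sub>i = (A\<^sub>0 - A\<^sub>i\<^sup>*) x\<^sub>0 + B\<^sub>0 u\<^sub>0\<close>, and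
  \<open>w\<^sub>i\<close> is the sum of the first \<open>i\<close> blocks of \<open>B_bar z\<close>, where \<open>z = (x\<^sub>0, u\<^sub>0)\<close> solves \<open>z' = D_bar z\<close>.
  The kernel of \<open>L\<^sub>1\<close> is the unobservable subspace of the pair \<open>(B_bar, D_bar)\<close>, so \<open>y = L\<^sub>1 z\<close> is
  an autonomous observable quotient, \<open>y' = (L\<^sub>1 D_bar L\<^sub>3) y\<close> and \<open>B_bar z = (B_bar L\<^sub>3) y\<close>.

  If all the matrices are Hurwitz, then \<open>y\<close> and every \<open>w\<^sub>i\<close> tend to 0, and input-to-state stability
  passes the convergence of the errors down the tree. Conversely, an unstable eigenvector of
  \<open>A\<^sub>i\<^sup>* - B\<^sub>i\<^sup>*\<close> is itself a non-decaying error, and an unstable eigenvalue \<open>l\<close> of the quotient yields,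
  by observability, a trajectory with \<open>w\<^sub>i(t) = exp (l t) w\<^sub>i(0)\<close> and some \<open>w\<^sub>i(0) \<noteq> 0\<close>, which is
  incompatible with vanishing errors.\<close>

section \<open>Exponential generating functions and stability of linear systems\<close>

definition geometrically_bounded :: "(nat \<Rightarrow> 'a::real_normed_field) \<Rightarrow> bool" where
  "geometrically_bounded c \<longleftrightarrow> (\<exists>S R. \<forall>k. norm (c k) \<le> S * R ^ k)"

text \<open>The number \<open>c k\<close> plays the role of the k-th derivative at 0.
  Differentiation becomes a shift of \<open>c\<close>, so a linear recurrence for \<open>c\<close>
  is a linear differential equation for \<open>egf c\<close>. This takes the place of the matrix
  exponential and serves real and complex solutions alike.\<close>

definition egf :: "(nat \<Rightarrow> 'a::{real_normed_field,banach}) \<Rightarrow> real \<Rightarrow> 'a" where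
  "egf c t = (\<Sum>k. c k / fact k * of_real t ^ k)"

text \<open>The sum of the norms over \<open>I\<close> grows in one step at most by the factor
  \<open>card I * M\<close>, and every single coefficient is below that sum.\<close>

lemma geometrically_bounded_recurrence:
  fixes c :: "nat \<Rightarrow> 'i \<Rightarrow> 'a::real_normed_field"
  assumes fin: "finite I" and M: "0 \<le> M"
    and step: "\<And>k p. p \<in> I \<Longrightarrow> norm (c (Suc k) p) \<le> M * (\<Sum>q\<in>I. norm (c k q))"
    and p: "p \<in> I"
  shows "geometrically_bounded (\<lambda>k. c k p)"
proof -
  let ?s = "\<lambda>k. \<Sum>q\<in>I. norm (c k q)"
  have s: "?s k \<le> ?s 0 * (real (card I) * M) ^ k" for k
  proof (induction k)
    case (Suc k)
    have "?s (Suc k) \<le> real (card I) * (M * ?s k)"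
      using sum_mono[of I "\<lambda>q. norm (c (Suc k) q)" "\<lambda>_. M * ?s k"] step by simp
    also have "\<dots> \<le> real (card I) * (M * (?s 0 * (real (card I) * M) ^ k))"
      by (intro mult_left_mono Suc.IH M) auto
    finally show ?case by (simp add: mult_ac)
  qed simp
  have "norm (c k p) \<le> ?s k" for k
    using member_le_sum[OF p, of "\<lambda>q. norm (c k q)"] fin by simp
  then show ?thesis
    unfolding geometrically_bounded_def using s order_trans by blast
qed

lemma geometrically_bounded_power: "geometrically_bounded (\<lambda>k. v * x ^ k)"
  unfolding geometrically_bounded_def
  by (intro exI[of _ "norm v"] exI[of _ "norm x"]) (simp add: norm_mult norm_power)

lemma geometrically_bounded_initial: "geometrically_bounded (\<lambda>k. if k = 0 then v else 0)"
  unfolding geometrically_bounded_def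
  by (intro exI[of _ "norm v"] exI[of _ 0]) simp

lemma geometrically_bounded_cmult:
  assumes "geometrically_bounded c"
  shows "geometrically_bounded (\<lambda>k. a * c k)"
proof -
  obtain S R where "\<forall>k. norm (c k) \<le> S * R ^ k"
    using assms unfolding geometrically_bounded_def by blast
  then have "\<forall>k. norm (a * c k) \<le> (norm a * S) * R ^ k"
    by (simp add: norm_mult mult.assoc mult_left_mono)
  then show ?thesis unfolding geometrically_bounded_def by blast
qed

lemma geometrically_bounded_add:
  assumes "geometrically_bounded c" "geometrically_bounded d"
  shows "geometrically_bounded (\<lambda>k. c k + d k)"
proof -
  obtain S R S' R' where c: "\<And>k. norm (c k) \<le> S * R ^ k" and d: "\<And>k. norm (d k) \<le> S' * R' ^ k"
    using assms unfolding geometrically_bounded_def by blast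
  \<comment> \<open>The definition does not fix the signs of the constants, so both bounds pass to
    absolute values before a common ratio is taken.\<close>
  have mono: "s * r ^ k \<le> \<bar>s\<bar> * max \<bar>R\<bar> \<bar>R'\<bar> ^ k" if "\<bar>r\<bar> \<le> max \<bar>R\<bar> \<bar>R'\<bar>" for s r :: real and k
  proof -
    have "s * r ^ k \<le> \<bar>s * r ^ k\<bar>" by simp
    also have "\<dots> = \<bar>s\<bar> * \<bar>r\<bar> ^ k" by (simp add: abs_mult power_abs)
    also have "\<dots> \<le> \<bar>s\<bar> * max \<bar>R\<bar> \<bar>R'\<bar> ^ k"
      using that by (intro mult_left_mono power_mono) auto
    finally show ?thesis .
  qed
  have "norm (c k + d k) \<le> (\<bar>S\<bar> + \<bar>S'\<bar>) * max \<bar>R\<bar> \<bar>R'\<bar> ^ k" for k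
    using norm_triangle_ineq[of "c k" "d k"] c[of k] d[of k] mono[of R S k] mono[of R' S' k]
    by (simp add: distrib_right)
  then show ?thesis unfolding geometrically_bounded_def by blast
qed

lemma geometrically_bounded_diff:
  assumes "geometrically_bounded c" "geometrically_bounded d"
  shows "geometrically_bounded (\<lambda>k. c k - d k)"
  using geometrically_bounded_add[OF assms(1) geometrically_bounded_cmult[OF assms(2), of "-1"]]
  by simp

lemma geometrically_bounded_sum:
  assumes "finite I" "\<And>i. i \<in> I \<Longrightarrow> geometrically_bounded (c i)"
  shows "geometrically_bounded (\<lambda>k. \<Sum>i\<in>I. a i * c i k)"
  using assms
proof (induction I)
  case empty
  then show ?case using geometrically_bounded_power[of 0 0] by simp
next
  case (insert i I)
  then show ?case by (simp add: geometrically_bounded_add geometrically_bounded_cmult)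
qed

lemma summable_egf:
  fixes c :: "nat \<Rightarrow> 'a::{real_normed_field,banach}"
  assumes "geometrically_bounded c"
  shows "summable (\<lambda>k. c k / fact k * z ^ k)"
proof -
  obtain S R where b: "\<And>k. norm (c k) \<le> S * R ^ k"
    using assms unfolding geometrically_bounded_def by blast
  show ?thesis
  proof (rule summable_comparison_test'[of "\<lambda>k. S * (inverse (fact k) * (R * norm z) ^ k)" 0])
    show "summable (\<lambda>k. S * (inverse (fact k) * (R * norm z) ^ k))"
      by (intro summable_mult summable_exp)
    fix k
    have "norm (c k / fact k * z ^ k) = norm (c k) * (inverse (fact k) * norm z ^ k)"
      by (simp add: norm_mult norm_divide norm_power field_simps)
    also have "\<dots> \<le> S * R ^ k * (inverse (fact k) * norm z ^ k)"
      by (intro mult_right_mono b) auto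
    finally show "norm (c k / fact k * z ^ k) \<le> S * (inverse (fact k) * (R * norm z) ^ k)"
      by (simp add: power_mult_distrib mult_ac)
  qed
qed

text \<open>Termwise differentiation takes place in the field variable \<open>z\<close>; composing
  with the embedding of the reals gives the derivative along the real line.\<close>

lemma egf_has_vector_derivative:
  fixes c :: "nat \<Rightarrow> 'a::{real_normed_field,banach}"
  assumes "geometrically_bounded c"
  shows "(egf c has_vector_derivative egf (\<lambda>k. c (Suc k)) t) (at t)"
proof -
  let ?f = "\<lambda>z. \<Sum>k. c k / fact k * z ^ k"
  have "(?f has_field_derivative (\<Sum>k. diffs (\<lambda>k. c k / fact k) k * of_real t ^ k)) (at (of_real t))"
    by (rule termdiffs_strong_converges_everywhere) (rule summable_egf[OF assms])
  moreover have "diffs (\<lambda>k. c k / fact k) k = c (Suc k) / fact k" for k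
    unfolding diffs_def by (simp add: field_simps del: of_nat_Suc)
  ultimately have "(?f has_derivative (\<lambda>h. h * egf (\<lambda>k. c (Suc k)) t)) (at (of_real t))"
    by (simp add: has_field_derivative_def egf_def mult_commute_abs)
  from has_derivative_compose[OF has_derivative_of_real[OF has_derivative_ident] this]
  show ?thesis
    unfolding has_vector_derivative_def egf_def scaleR_conv_of_real .
qed

lemma egf_cmult:
  assumes "geometrically_bounded c"
  shows "egf (\<lambda>k. a * c k) t = a * egf c t"
  using suminf_mult[OF summable_egf[OF assms, of "of_real t"], of a]
  by (simp add: egf_def mult_ac)

lemma egf_add:
  assumes "geometrically_bounded c" "geometrically_bounded d"
  shows "egf (\<lambda>k. c k + d k) t = egf c t + egf d t"
  using suminf_add[OF assms[THEN summable_egf, of "of_real t"]]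
  by (simp add: egf_def add_divide_distrib distrib_right)

lemma egf_diff:
  assumes "geometrically_bounded c" "geometrically_bounded d"
  shows "egf (\<lambda>k. c k - d k) t = egf c t - egf d t"
  using suminf_diff[OF assms[THEN summable_egf, of "of_real t"]]
  by (simp add: egf_def diff_divide_distrib left_diff_distrib)

lemma egf_sum:
  assumes "finite I" "\<And>i. i \<in> I \<Longrightarrow> geometrically_bounded (c i)"
  shows "egf (\<lambda>k. \<Sum>i\<in>I. a i * c i k) t = (\<Sum>i\<in>I. a i * egf (c i) t)"
  using assms
proof (induction I)
  case empty
  then show ?case by (simp add: egf_def)
next
  case (insert i I)
  then show ?case
    by (simp add: egf_add egf_cmult geometrically_bounded_cmult geometrically_bounded_sum)
qed

text \<open>A constant function has its 0-th coefficient as the only one that can be nonzero; this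
  is how the leader's constant input enters the series.\<close>

lemma egf_initial: "egf (\<lambda>k. if k = 0 then v else 0) t = v"
proof -
  have "(\<lambda>k. (if k = 0 then v else 0) / fact k * of_real t ^ k) = (\<lambda>k. if k = 0 then v else 0)"
    by auto
  then show ?thesis
    using suminf_finite[of "{0}" "\<lambda>k. if k = 0 then v else 0"] by (simp add: egf_def)
qed

lemma egf_power: "egf (\<lambda>k. v * x ^ k) t = v * exp (x * of_real t)"
proof -
  have "egf (\<lambda>k. x ^ k) t = exp (x * of_real t)"
    by (simp add: egf_def exp_def scaleR_conv_of_real power_mult_distrib divide_inverse mult_ac)
  then show ?thesis
    using egf_cmult[OF geometrically_bounded_power[of 1 x]] by simp
qed

lemma egf_Re:
  assumes "geometrically_bounded c"
  shows "egf (\<lambda>k. Re (c k)) t = Re (egf c t)"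
proof -
  have "Re (c k / fact k * of_real t ^ k) = Re (c k) / fact k * of_real t ^ k" for k
  proof -
    have "c k / fact k * of_real t ^ k = (t ^ k / fact k) *\<^sub>R c k"
      by (simp add: scaleR_conv_of_real)
    then show ?thesis by simp
  qed
  then show ?thesis
    using sums_Re[OF summable_sums[OF summable_egf[OF assms, of "of_real t"]]]
    unfolding egf_def by (simp add: sums_iff)
qed

lemma egf_Im:
  assumes "geometrically_bounded c"
  shows "egf (\<lambda>k. Im (c k)) t = Im (egf c t)"
proof -
  have "Im (c k / fact k * of_real t ^ k) = Im (c k) / fact k * of_real t ^ k" for k
  proof -
    have "c k / fact k * of_real t ^ k = (t ^ k / fact k) *\<^sub>R c k"
      by (simp add: scaleR_conv_of_real)
    then show ?thesis by simp
  qed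
  then show ?thesis
    using sums_Im[OF summable_sums[OF summable_egf[OF assms, of "of_real t"]]]
    unfolding egf_def by (simp add: sums_iff)
qed

section \<open>Mean value inequality and scalar linear equations\<close>

lemma vector_derivative_norm_bound:
  fixes h :: "real \<Rightarrow> complex"
  assumes "a \<le> b"
    and h: "\<And>t. a \<le> t \<Longrightarrow> t \<le> b \<Longrightarrow> (h has_vector_derivative h' t) (at t)"
    and p: "\<And>t. a \<le> t \<Longrightarrow> t \<le> b \<Longrightarrow> (\<phi> has_real_derivative \<phi>' t) (at t)"
    and le: "\<And>t. a \<le> t \<Longrightarrow> t \<le> b \<Longrightarrow> norm (h' t) \<le> \<phi>' t"
  shows "norm (h b - h a) \<le> \<phi> b - \<phi> a"
proof -
  \<comment> \<open>The factor \<open>u\<close> turns the increment \<open>h b - h a\<close> onto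
    the nonnegative real axis; the claim then follows from the monotonicity of the real function
    \<open>\<phi> t - Re (u * h t)\<close>.\<close>
  define u where "u = cnj (sgn (h b - h a))"
  have u: "norm u \<le> 1" "Re (u * (h b - h a)) = norm (h b - h a)"
  proof -
    show "norm u \<le> 1" by (simp add: u_def norm_sgn)
    have "u * (h b - h a) = of_real (norm (h b - h a))"
    proof (cases "h b = h a")
      case False
      have "u * (h b - h a) = cnj (h b - h a) * (h b - h a) / of_real (norm (h b - h a))"
        by (simp add: u_def sgn_div_norm scaleR_conv_of_real divide_inverse)
      also have "cnj (h b - h a) * (h b - h a) = of_real (norm (h b - h a) ^ 2)"
        by (metis complex_norm_square mult.commute)
      finally show ?thesis using False by (simp add: power2_eq_square)
    qed simp
    then show "Re (u * (h b - h a)) = norm (h b - h a)" by simp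
  qed
  have "(\<lambda>t. \<phi> t - Re (u * h t)) a \<le> (\<lambda>t. \<phi> t - Re (u * h t)) b"
  proof (rule DERIV_nonneg_imp_nondecreasing[OF \<open>a \<le> b\<close>])
    fix t assume t: "a \<le> t" "t \<le> b"
    have "((\<lambda>t. u * h t) has_vector_derivative u * h' t) (at t)"
      using has_vector_derivative_mult[OF has_vector_derivative_const h[OF t], of u] by simp
    then have "((\<lambda>t. Re (u * h t)) has_real_derivative Re (u * h' t)) (at t)"
      by (simp add: has_vector_derivative_complex_iff)
    then have "((\<lambda>t. \<phi> t - Re (u * h t)) has_real_derivative \<phi>' t - Re (u * h' t)) (at t)"
      by (intro DERIV_diff p t)
    moreover have "Re (u * h' t) \<le> \<phi>' t"
    proof -
      have "Re (u * h' t) \<le> norm u * norm (h' t)"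
        using complex_Re_le_cmod[of "u * h' t"] by (simp add: norm_mult)
      also have "\<dots> \<le> 1 * norm (h' t)" by (intro mult_right_mono u) auto
      finally show ?thesis using le[OF t] by simp
    qed
    ultimately show "\<exists>y. ((\<lambda>t. \<phi> t - Re (u * h t)) has_real_derivative y) (at t) \<and> 0 \<le> y"
      by (intro exI[of _ "\<phi>' t - Re (u * h' t)"]) auto
  qed
  then show ?thesis using u(2) by (simp add: right_diff_distrib)
qed

text \<open>If \<open>c\<close> were nonzero, \<open>g\<close> would eventually drift almost
  linearly in the direction of \<open>c\<close> and could not stay bounded.\<close>

lemma derivative_limit_zero:
  fixes g :: "real \<Rightarrow> complex"
  assumes g: "\<And>t. 0 < t \<Longrightarrow> (g has_vector_derivative g' t) (at t)"
    and lim: "(g \<longlongrightarrow> 0) at_top" and lim': "(g' \<longlongrightarrow> c) at_top"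
  shows "c = 0"
proof (rule ccontr)
  assume c: "c \<noteq> 0"
  have "eventually (\<lambda>t. norm (g' t - c) \<le> norm c / 2 \<and> norm (g t) \<le> 1) at_top"
    using eventually_conj[OF tendstoD[OF lim', of "norm c / 2"] tendstoD[OF lim, of 1]] c
    by (auto simp: dist_norm elim!: eventually_mono)
  then obtain T0 where T0: "\<And>t. T0 \<le> t \<Longrightarrow> norm (g' t - c) \<le> norm c / 2 \<and> norm (g t) \<le> 1"
    unfolding eventually_at_top_linorder by blast
  define T where "T = max T0 1"
  \<comment> \<open>The length \<open>5 / norm c\<close> makes the linear drift equal to 5. The
    increment of \<open>g\<close> deviates from it by at most \<open>5 / 2\<close> and is itself at
    most 2 in norm, which is impossible because \<open>5 - 2 > 5 / 2\<close>.\<close>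
  define s where "s = T + 5 / norm c"
  have "T \<le> s" by (simp add: s_def)
  have T: "norm (g' t - c) \<le> norm c / 2" "norm (g t) \<le> 1" "0 < t" if "T \<le> t" for t
    using T0[of t] that by (auto simp: T_def)
  have "norm ((g s - of_real s * c) - (g T - of_real T * c)) \<le> norm c / 2 * s - norm c / 2 * T"
  proof (rule vector_derivative_norm_bound[OF \<open>T \<le> s\<close>, where h' = "\<lambda>t. g' t - c"
        and \<phi>' = "\<lambda>_. norm c / 2"])
    fix t assume t: "T \<le> t"
    show "((\<lambda>t. g t - of_real t * c) has_vector_derivative g' t - c) (at t)"
    proof (rule has_vector_derivative_diff[OF g[OF T(3)[OF t]]])
      show "((\<lambda>t. of_real t * c) has_vector_derivative c) (at t)"
        unfolding has_vector_derivative_def scaleR_conv_of_real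
        by (auto intro!: derivative_eq_intros)
    qed
    show "((\<lambda>t. norm c / 2 * t) has_real_derivative norm c / 2) (at t)"
      by (auto intro!: derivative_eq_intros)
    show "norm (g' t - c) \<le> norm c / 2" by (rule T(1)[OF t])
  qed
  then have "norm (of_real (s - T) * c) - norm (g s - g T) \<le> norm c / 2 * (s - T)"
    using norm_triangle_ineq2[of "of_real (s - T) * c" "g s - g T"]
    by (simp add: norm_minus_commute algebra_simps)
  moreover have "norm (g s - g T) \<le> 2"
    using norm_triangle_ineq4[of "g s" "g T"] T(2)[of s] T(2)[of T] \<open>T \<le> s\<close> by simp
  moreover have "norm (of_real (s - T) * c) = 5" "norm c / 2 * (s - T) = 5 / 2"
    using c by (simp_all add: s_def norm_mult norm_divide)
  ultimately show False by simp
qed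

lemma exp_has_vector_derivative:
  "((\<lambda>t. exp (l * complex_of_real t)) has_vector_derivative exp (l * of_real t) * l) (at t)"
proof -
  have "((\<lambda>z. exp (l * z)) has_field_derivative exp (l * of_real t) * l) (at (of_real t))"
    by (auto intro!: derivative_eq_intros)
  then have "((\<lambda>t. exp (l * complex_of_real t)) has_derivative
      (\<lambda>h. exp (l * of_real t) * l * of_real h)) (at t)"
    unfolding has_field_derivative_def
    by (rule has_derivative_compose[OF has_derivative_of_real[OF has_derivative_ident]])
  then show ?thesis by (simp add: has_vector_derivative_def scaleR_conv_of_real mult_ac)
qed

text \<open>With the integrating factor \<open>exp (- l t)\<close> only the input remains in the
  derivative. Once the input is below \<open>\<delta>\<close>, integration leaves a decaying share
  of \<open>g T\<close> plus at most \<open>\<delta> / \<alpha>\<close>, where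
  \<open>\<alpha>\<close> is the decay rate.\<close>

lemma scalar_input_to_state_stable:
  fixes g r :: "real \<Rightarrow> complex"
  assumes g: "\<And>t. 0 < t \<Longrightarrow> (g has_vector_derivative l * g t + r t) (at t)"
    and l: "Re l < 0" and r: "(r \<longlongrightarrow> 0) at_top"
  shows "(g \<longlongrightarrow> 0) at_top"
proof (rule tendstoI)
  fix e :: real assume e: "0 < e"
  define \<alpha> where "\<alpha> = - Re l"
  \<comment> \<open>This makes the persistent contribution \<open>\<delta> / \<alpha>\<close> of the
    input equal to \<open>e / 2\<close>.\<close>
  define \<delta> where "\<delta> = \<alpha> * e / 2"
  have pos: "0 < \<alpha>" "0 < \<delta>" using l e by (auto simp: \<alpha>_def \<delta>_def mult_neg_pos)
  obtain T0 where T0: "\<And>t. T0 \<le> t \<Longrightarrow> norm (r t) < \<delta>"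
    using tendstoD[OF r \<open>0 < \<delta>\<close>] unfolding eventually_at_top_linorder by auto
  define T where "T = max T0 1"
  have T: "norm (r t) \<le> \<delta>" "0 < t" if "T \<le> t" for t
    using T0[of t] that by (auto simp: T_def)
  have bound: "norm (g t) \<le> norm (g T) * exp (\<alpha> * T) * exp (- \<alpha> * t) + e / 2" if t: "T \<le> t" for t
  proof -
    let ?h = "\<lambda>t. exp (- l * of_real t) * g t"
    let ?\<phi> = "\<lambda>t. \<delta> / \<alpha> * exp (\<alpha> * t)"
    have ne: "norm (exp (- l * of_real s)) = exp (\<alpha> * s)" for s
      by (simp add: \<alpha>_def)
    have "norm (?h t - ?h T) \<le> ?\<phi> t - ?\<phi> T"
    proof (rule vector_derivative_norm_bound[OF t, where h' = "\<lambda>s. exp (- l * of_real s) * r s"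
          and \<phi>' = "\<lambda>s. \<delta> * exp (\<alpha> * s)"])
      fix s assume s: "T \<le> s"
      from has_vector_derivative_mult[OF exp_has_vector_derivative g[OF T(2)[OF s]], of "- l"]
      show "(?h has_vector_derivative exp (- l * of_real s) * r s) (at s)"
        by (simp add: algebra_simps)
      show "(?\<phi> has_real_derivative \<delta> * exp (\<alpha> * s)) (at s)"
        using pos by (auto intro!: derivative_eq_intros)
      show "norm (exp (- l * of_real s) * r s) \<le> \<delta> * exp (\<alpha> * s)"
        unfolding norm_mult ne using T(1)[OF s] by (simp add: mult.commute mult_left_mono)
    qed
    then have "norm (?h t) \<le> norm (?h T) + \<delta> / \<alpha> * exp (\<alpha> * t)"
      using norm_triangle_ineq2[of "?h t" "?h T"] pos by (smt (verit) divide_nonneg_pos exp_ge_zero mult_nonneg_nonneg)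
    then have "exp (\<alpha> * t) * norm (g t) \<le> exp (\<alpha> * T) * norm (g T) + e / 2 * exp (\<alpha> * t)"
      unfolding norm_mult ne using pos by (simp add: \<delta>_def)
    then have "exp (- \<alpha> * t) * (exp (\<alpha> * t) * norm (g t))
        \<le> exp (- \<alpha> * t) * (exp (\<alpha> * T) * norm (g T) + e / 2 * exp (\<alpha> * t))"
      by (intro mult_left_mono) auto
    moreover have "exp (- \<alpha> * t) * exp (\<alpha> * t) = 1" by (simp flip: exp_add)
    ultimately show ?thesis by (simp add: algebra_simps)
  qed
  have "filterlim (\<lambda>t. - \<alpha> * t) at_bot at_top"
    using pos by (intro filterlim_tendsto_neg_mult_at_bot[OF tendsto_const _ filterlim_ident]) auto
  then have "((\<lambda>t. norm (g T) * exp (\<alpha> * T) * exp (- \<alpha> * t)) \<longlongrightarrow> norm (g T) * exp (\<alpha> * T) * 0) at_top"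
    by (intro tendsto_mult tendsto_const filterlim_compose[OF exp_at_bot])
  then have "eventually (\<lambda>t. norm (g T) * exp (\<alpha> * T) * exp (- \<alpha> * t) < e / 2) at_top"
    using order_tendstoD(2)[of _ 0 at_top "e / 2"] e by simp
  then show "eventually (\<lambda>t. dist (g t) 0 < e) at_top"
    using eventually_ge_at_top[of T]
  proof eventually_elim
    case (elim t)
    then show ?case using bound[of t] by simp
  qed
qed

section \<open>Triangularization and input-to-state stability\<close>

lemma schur_triangularization:
  fixes Q :: "complex mat"
  assumes Q: "Q \<in> carrier_mat d d"
  obtains U P P' where "U \<in> carrier_mat d d" "P \<in> carrier_mat d d" "P' \<in> carrier_mat d d"
    "P * P' = 1\<^sub>m d" "P' * Q = U * P'" "upper_triangular U"
    "\<And>a. a < d \<Longrightarrow> eigenvalue Q (U $$ (a, a))"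
proof -
  obtain es where es: "char_poly Q = (\<Prod>a\<leftarrow>es. [:- a, 1:])"
    using char_poly_factorized[OF Q] by blast
  obtain U P P' where dec: "schur_decomposition Q es = (U, P, P')"
    by (cases "schur_decomposition Q es")
  from schur_decomposition[OF Q es dec]
  have sim: "similar_mat_wit Q U P P'" and U: "upper_triangular U" and diag: "diag_mat U = es"
    by auto
  from similar_mat_witD2[OF Q sim]
  have c: "U \<in> carrier_mat d d" "P \<in> carrier_mat d d" "P' \<in> carrier_mat d d"
    and inv: "P * P' = 1\<^sub>m d" "P' * P = 1\<^sub>m d" and eq: "Q = P * U * P'"
    by auto
  have "P' * Q = (P' * P) * U * P'"
    unfolding eq using c by (simp add: assoc_mult_mat[of _ d d _ d _ d])
  then have "P' * Q = U * P'" using inv c by simp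
  moreover have "eigenvalue Q (U $$ (a, a))" if "a < d" for a
  proof -
    have "U $$ (a, a) \<in> set es" using that c unfolding diag[symmetric] diag_mat_def by auto
    then have "poly (char_poly Q) (U $$ (a, a)) = 0"
      unfolding es poly_prod_list by (auto simp: prod_list_zero_iff intro!: image_eqI)
    then show ?thesis using eigenvalue_root_char_poly[OF Q] by simp
  qed
  ultimately show ?thesis using that c inv U by blast
qed

text \<open>In the coordinates \<open>g = P' y\<close> the system is upper triangular with
  eigenvalues on the diagonal, so each component solves a stable scalar equation driven by the later
  components and by \<open>r\<close>. Going from the last component to the first, every such input
  tends to 0, and \<open>P\<close> carries the result back to \<open>y\<close>.\<close>

lemma input_to_state_stable_complex:
  fixes Q :: "complex mat" and y f :: "nat \<Rightarrow> real \<Rightarrow> complex"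
  assumes Q: "Q \<in> carrier_mat d d" and stable: "\<And>l. eigenvalue Q l \<Longrightarrow> Re l < 0"
    and y: "\<And>a t. a < d \<Longrightarrow> 0 < t \<Longrightarrow>
      (y a has_vector_derivative (\<Sum>b<d. Q $$ (a, b) * y b t) + f a t) (at t)"
    and f: "\<And>a. a < d \<Longrightarrow> (f a \<longlongrightarrow> 0) at_top"
    and a: "a < d"
  shows "(y a \<longlongrightarrow> 0) at_top"
proof -
  obtain U P P' where c: "U \<in> carrier_mat d d" "P \<in> carrier_mat d d" "P' \<in> carrier_mat d d"
    and inv: "P * P' = 1\<^sub>m d" and comm: "P' * Q = U * P'" and ut: "upper_triangular U"
    and ev: "\<And>a. a < d \<Longrightarrow> eigenvalue Q (U $$ (a, a))"
    using schur_triangularization[OF Q] by blast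
  define g where "g a t = (\<Sum>b<d. P' $$ (a, b) * y b t)" for a t
  define r where "r a t = (\<Sum>b<d. P' $$ (a, b) * f b t)" for a t
  have comm': "(\<Sum>b<d. P' $$ (a, b) * Q $$ (b, j)) = (\<Sum>b<d. U $$ (a, b) * P' $$ (b, j))"
    if "a < d" "j < d" for a j
    using arg_cong[OF comm, of "\<lambda>M. M $$ (a, j)"] that c Q
    by (simp add: scalar_prod_def lessThan_atLeast0)
  have g': "(g a has_vector_derivative (\<Sum>b<d. U $$ (a, b) * g b t) + r a t) (at t)"
    if a: "a < d" and t: "0 < t" for a t
  proof -
    have "(g a has_vector_derivative
        (\<Sum>b<d. P' $$ (a, b) * ((\<Sum>j<d. Q $$ (b, j) * y j t) + f b t))) (at t)"
      unfolding g_def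
      by (intro has_vector_derivative_sum)
        (use has_vector_derivative_mult[OF has_vector_derivative_const y[OF _ t]] in auto)
    also have "(\<Sum>b<d. P' $$ (a, b) * ((\<Sum>j<d. Q $$ (b, j) * y j t) + f b t))
        = (\<Sum>b<d. \<Sum>j<d. P' $$ (a, b) * Q $$ (b, j) * y j t) + r a t"
      by (simp add: distrib_left sum.distrib sum_distrib_left r_def mult.assoc)
    also have "(\<Sum>b<d. \<Sum>j<d. P' $$ (a, b) * Q $$ (b, j) * y j t)
        = (\<Sum>j<d. (\<Sum>b<d. P' $$ (a, b) * Q $$ (b, j)) * y j t)"
      by (subst sum.swap) (simp add: sum_distrib_right)
    also have "\<dots> = (\<Sum>j<d. (\<Sum>b<d. U $$ (a, b) * P' $$ (b, j)) * y j t)"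
      using a by (intro sum.cong refl) (simp add: comm')
    also have "\<dots> = (\<Sum>b<d. U $$ (a, b) * g b t)"
      unfolding g_def sum_distrib_left sum_distrib_right
      by (subst sum.swap) (simp add: mult.assoc)
    finally show ?thesis .
  qed
  have r0: "(r a \<longlongrightarrow> 0) at_top" for a
    unfolding r_def by (rule tendsto_null_sum) (auto intro!: tendsto_mult_right_zero f)
  have g0: "(g a \<longlongrightarrow> 0) at_top" if "a < d" for a
    using that
  proof (induction "d - a" arbitrary: a rule: less_induct)
    case less
    let ?s = "\<lambda>t. (\<Sum>b\<in>{a<..<d}. U $$ (a, b) * g b t) + r a t"
    have s: "(?s \<longlongrightarrow> 0) at_top"
      using less by (intro tendsto_add_zero tendsto_null_sum tendsto_mult_right_zero r0) auto
    show ?case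
    proof (rule scalar_input_to_state_stable[OF _ stable[OF ev[OF less.prems]] s])
      fix t :: real assume t: "0 < t"
      have "(\<Sum>b<d. U $$ (a, b) * g b t) = (\<Sum>b\<in>{a..<d}. U $$ (a, b) * g b t)"
        using ut c less.prems by (intro sum.mono_neutral_right) (auto simp: not_le)
      also have "{a..<d} = insert a {a<..<d}" using less.prems by auto
      finally show "(g a has_vector_derivative U $$ (a, a) * g a t + ?s t) (at t)"
        using g'[OF less.prems t] by (simp add: add.assoc)
    qed
  qed
  have "y a t = (\<Sum>b<d. P $$ (a, b) * g b t)" for t
  proof -
    have "(\<Sum>b<d. P $$ (a, b) * g b t) = (\<Sum>j<d. (\<Sum>b<d. P $$ (a, b) * P' $$ (b, j)) * y j t)"
      unfolding g_def sum_distrib_left sum_distrib_right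
      by (subst sum.swap) (simp add: mult.assoc)
    also have "\<dots> = (\<Sum>j<d. (if a = j then 1 else 0) * y j t)"
    proof (intro sum.cong refl)
      fix j assume "j \<in> {..<d}"
      then show "(\<Sum>b<d. P $$ (a, b) * P' $$ (b, j)) * y j t = (if a = j then 1 else 0) * y j t"
        using arg_cong[OF inv, of "\<lambda>M. M $$ (a, j)"] a c
        by (simp add: scalar_prod_def lessThan_atLeast0)
    qed
    also have "\<dots> = y a t" using a by (simp add: if_distrib if_distribR sum.delta cong: if_cong)
    finally show ?thesis by simp
  qed
  then have "y a = (\<lambda>t. \<Sum>b<d. P $$ (a, b) * g b t)" by blast
  then show ?thesis
    using g0 by (auto intro!: tendsto_null_sum tendsto_mult_right_zero)
qed

lemma input_to_state_stable:
  fixes Q :: "real mat" and y f :: "nat \<Rightarrow> real \<Rightarrow> real"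
  assumes Q: "Q \<in> carrier_mat d d" and stable: "hurwitz Q"
    and y: "\<And>a t. a < d \<Longrightarrow> 0 < t \<Longrightarrow>
      (y a has_real_derivative (\<Sum>b<d. Q $$ (a, b) * y b t) + f a t) (at t)"
    and f: "\<And>a. a < d \<Longrightarrow> (f a \<longlongrightarrow> 0) at_top"
    and a: "a < d"
  shows "(y a \<longlongrightarrow> 0) at_top"
proof -
  have "((\<lambda>t. complex_of_real (y a t)) \<longlongrightarrow> 0) at_top"
  proof (rule input_to_state_stable_complex[where Q = "map_mat complex_of_real Q" and d = d
        and f = "\<lambda>a t. complex_of_real (f a t)" and y = "\<lambda>a t. complex_of_real (y a t)"])
    show "Re l < 0" if "eigenvalue (map_mat complex_of_real Q) l" for l
      using stable that by (simp add: hurwitz_def)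
    show "((\<lambda>t. complex_of_real (f a t)) \<longlongrightarrow> 0) at_top" if "a < d" for a
      using tendsto_of_real[OF f[OF that]] by simp
    fix b t assume b: "b < d" and t: "(0::real) < t"
    show "((\<lambda>t. complex_of_real (y b t)) has_vector_derivative
        (\<Sum>j<d. map_mat complex_of_real Q $$ (b, j) * complex_of_real (y j t)) + complex_of_real (f b t)) (at t)"
      using has_vector_derivative_of_real[OF y[OF b t], where 'a = complex] Q b by simp
  qed (use Q a in auto)
  then show ?thesis using tendsto_Re by fastforce
qed

section \<open>The observable quotient\<close>

lemma mult_mat_vec_eq_zero_iff:
  assumes "A \<in> carrier_mat nr nc"
  shows "A *\<^sub>v u = 0\<^sub>v nr \<longleftrightarrow> (\<forall>r\<in>set (rows A). r \<bullet> u = 0)"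
  using assms by (auto simp: rows_def vec_eq_iff)

lemma set_rows_append_rows:
  assumes A: "A \<in> carrier_mat nr1 nc" and B: "B \<in> carrier_mat nr2 nc"
  shows "set (rows (A @\<^sub>r B)) = set (rows A) \<union> set (rows B)"
proof -
  have "row (A @\<^sub>r B) i = (if i < nr1 then row A i else row B (i - nr1))" if "i < nr1 + nr2" for i
    using that A B by (intro eq_vecI) (auto simp: append_rows_def)
  moreover have "{0..<nr1 + nr2} = {0..<nr1} \<union> (\<lambda>i. i + nr1) ` {0..<nr2}"
    by auto
  ultimately have "row (A @\<^sub>r B) ` {0..<nr1 + nr2} = row A ` {0..<nr1} \<union> row B ` {0..<nr2}"
    by (simp only: image_Un image_image) (simp cong: image_cong_simp)
  then show ?thesis
    unfolding rows_def set_map set_upt carrier_matD(1)[OF A] carrier_matD(1)[OF B]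
      carrier_matD(1)[OF carrier_append_rows[OF A B]] .
qed

lemma V_mat_carrier:
  assumes "Bb \<in> carrier_mat r c" "Db \<in> carrier_mat c c"
  shows "V_mat Bb Db k \<in> carrier_mat (Suc k * r) c"
proof (induction k)
  case (Suc k)
  have "Bb * Db ^\<^sub>m Suc k \<in> carrier_mat r c"
    using assms by (intro mult_carrier_mat[of _ r c]) auto
  from carrier_append_rows[OF Suc.IH this] show ?case
    by (simp add: algebra_simps)
qed (use assms in simp)

lemma set_rows_V_mat:
  assumes "Bb \<in> carrier_mat r c" "Db \<in> carrier_mat c c"
  shows "set (rows (V_mat Bb Db k)) = (\<Union>j\<le>k. set (rows (Bb * Db ^\<^sub>m j)))"
proof (induction k)
  case 0
  then show ?case using assms by simp
next
  case (Suc k)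
  have "Bb * Db ^\<^sub>m Suc k \<in> carrier_mat r c"
    using assms by (intro mult_carrier_mat[of _ r c]) auto
  from set_rows_append_rows[OF V_mat_carrier[OF assms] this]
  show ?case using Suc.IH by (simp add: atMost_Suc Un_commute)
qed

text \<open>A kernel depends only on the set of rows, and stacking unites the row sets. As
  \<open>k\<close> grows, these kernels decrease to the unobservable subspace of the pair.\<close>

lemma mat_kernel_V_mat:
  assumes B: "Bb \<in> carrier_mat r c" and D: "Db \<in> carrier_mat c c"
  shows "u \<in> mat_kernel (V_mat Bb Db k) \<longleftrightarrow>
    u \<in> carrier_vec c \<and> (\<forall>j\<le>k. Bb * Db ^\<^sub>m j *\<^sub>v u = 0\<^sub>v r)"
proof -
  have "Bb * Db ^\<^sub>m j \<in> carrier_mat r c" for j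
    using assms by (intro mult_carrier_mat[of _ r c]) auto
  from mult_mat_vec_eq_zero_iff[OF this] show ?thesis
    unfolding mat_kernel[OF V_mat_carrier[OF assms]] mem_Collect_eq
      mult_mat_vec_eq_zero_iff[OF V_mat_carrier[OF assms]] set_rows_V_mat[OF assms]
    by auto
qed

text \<open>This turns equality of the ranks of successive \<open>V_mat\<close> into equality of
  kernel dimensions, which for nested kernels means equality of the kernels.\<close>

lemma rank_nullity_mat:
  fixes A :: "real mat"
  assumes A: "A \<in> carrier_mat nr nc"
  shows "mat_rank A + kernel.dim nc A = nc"
proof -
  interpret V: vec_space "TYPE(real)" nc .
  interpret W: vec_space "TYPE(real)" nr .
  interpret L: linear_map class_ring "module_vec TYPE(real) nc" "module_vec TYPE(real) nr" "\<lambda>v. A *\<^sub>v v"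
    by unfold_locales
      (use A in \<open>auto simp: LinearCombinations.module_hom_def module_vec_simps class_ring_simps
         mult_add_distrib_mat_vec mult_mat_vec\<close>)
  have "L.imT = W.col_space A"
    unfolding L.im_def W.col_space_eq[OF A] using A by (auto simp: module_vec_simps)
  moreover have "L.kerT = mat_kernel A"
    unfolding L.ker_def mat_kernel[OF A] by (auto simp: module_vec_simps)
  ultimately show ?thesis
    using L.rank_nullity[OF V.fin_dim] A
    by (simp add: mat_rank_def W.rank_def W.col_space_def V.dim_is_n)
qed

text \<open>A basis of the smaller kernel stays independent in the larger one; when the dimensions
  agree it is already a basis of both.\<close>

lemma kernel_dim_mono:
  fixes A B :: "'a::field mat"
  assumes A: "A \<in> carrier_mat nr nc" and B: "B \<in> carrier_mat nr' nc"
    and sub: "mat_kernel A \<subseteq> mat_kernel B"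
  shows "kernel.dim nc A \<le> kernel.dim nc B"
    and "kernel.dim nc A = kernel.dim nc B \<Longrightarrow> mat_kernel A = mat_kernel B"
proof -
  interpret KA: kernel nr nc A by unfold_locales (rule A)
  interpret KB: kernel nr' nc B by unfold_locales (rule B)
  obtain S where S: "finite S" "KA.basis S" using kernel_basis_exists[OF A] by blast
  have SA: "S \<subseteq> mat_kernel A" and li: "\<not> KA.lin_dep S" and gen: "KA.span S = mat_kernel A"
    using S(2) unfolding KA.Ker.basis_def by auto
  have SB: "S \<subseteq> mat_kernel B" using SA sub by blast
  have liB: "\<not> KB.lin_dep S"
    using li unfolding KA.lindep_same[OF SA] KB.lindep_same[OF SB] .
  have finB: "KB.Ker.fin_dim"
    using kernel_basis_exists[OF B] unfolding KB.Ker.fin_dim_def KB.Ker.basis_def by auto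
  have card: "kernel.dim nc A = card S" by (rule KA.Ker.dim_basis[OF S])
  show "kernel.dim nc A \<le> kernel.dim nc B"
    unfolding card using KB.Ker.li_le_dim(2)[OF finB _ liB] SB by simp
  assume "kernel.dim nc A = kernel.dim nc B"
  then have "KB.basis S"
    using KB.Ker.dim_li_is_basis[OF finB S(1) _ liB] SB card by simp
  then have "KB.span S = mat_kernel B" unfolding KB.Ker.basis_def by auto
  then show "mat_kernel A = mat_kernel B"
    using gen unfolding KA.span_same[OF SA] KB.span_same[OF SB] by simp
qed

text \<open>The \<open>LEAST\<close> in \<open>s_index\<close> is attained: otherwise the rank would
  rise by at least one at every step and exceed the number \<open>c\<close> of columns.\<close>

lemma s_index_rank:
  assumes B: "Bb \<in> carrier_mat r c" and D: "Db \<in> carrier_mat c c"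
  shows "mat_rank (V_mat Bb Db (s_index Bb Db)) = mat_rank (V_mat Bb Db (Suc (s_index Bb Db)))"
proof -
  let ?V = "V_mat Bb Db"
  note V = V_mat_carrier[OF B D]
  have mono: "mat_rank (?V k) \<le> mat_rank (?V (Suc k))" for k
  proof -
    have "mat_kernel (?V (Suc k)) \<subseteq> mat_kernel (?V k)"
      unfolding subset_iff mat_kernel_V_mat[OF B D] by simp
    from kernel_dim_mono(1)[OF V V this] show ?thesis
      using rank_nullity_mat[OF V[of k]] rank_nullity_mat[OF V[of "Suc k"]] by linarith
  qed
  have "\<exists>k. mat_rank (?V k) = mat_rank (?V (Suc k))"
  proof (rule ccontr)
    assume ne: "\<nexists>k. mat_rank (?V k) = mat_rank (?V (Suc k))"
    have "k \<le> mat_rank (?V k)" for k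
    proof (induction k)
      case (Suc k)
      then show ?case using mono[of k] ne by (metis Suc_leI le_less_trans order_le_less)
    qed simp
    from this[of "Suc c"] show False using rank_nullity_mat[OF V[of "Suc c"]] by linarith
  qed
  then show ?thesis unfolding s_index_def by (rule LeastI_ex)
qed

text \<open>Equal ranks at \<open>s_index\<close> and at its successor make the two kernels equal.
  Thus the products up to one order higher annihilate \<open>u\<close> as well, and passing from
  \<open>u\<close> to \<open>Db *\<^sub>v u\<close> costs just that one order.\<close>

lemma mat_kernel_V_mat_invariant:
  fixes Bb :: "real mat"
  assumes B: "Bb \<in> carrier_mat r c" and D: "Db \<in> carrier_mat c c"
    and u: "u \<in> mat_kernel (V_mat Bb Db (s_index Bb Db))"
  shows "Db *\<^sub>v u \<in> mat_kernel (V_mat Bb Db (s_index Bb Db))"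
proof -
  let ?s = "s_index Bb Db"
  note V = V_mat_carrier[OF B D]
  have "mat_kernel (V_mat Bb Db (Suc ?s)) \<subseteq> mat_kernel (V_mat Bb Db ?s)"
    unfolding subset_iff mat_kernel_V_mat[OF B D] by simp
  from kernel_dim_mono(2)[OF V V this]
  have "mat_kernel (V_mat Bb Db (Suc ?s)) = mat_kernel (V_mat Bb Db ?s)"
    using rank_nullity_mat[OF V[of ?s]] rank_nullity_mat[OF V[of "Suc ?s"]] s_index_rank[OF B D]
    by linarith
  with u have "u \<in> mat_kernel (V_mat Bb Db (Suc ?s))" by simp
  then have u': "u \<in> carrier_vec c" "\<And>j. j \<le> Suc ?s \<Longrightarrow> Bb * Db ^\<^sub>m j *\<^sub>v u = 0\<^sub>v r"
    unfolding mat_kernel_V_mat[OF B D] by blast+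
  have step: "Bb * Db ^\<^sub>m j *\<^sub>v (Db *\<^sub>v u) = Bb * Db ^\<^sub>m Suc j *\<^sub>v u" for j
  proof -
    have P: "Db ^\<^sub>m j \<in> carrier_mat c c" using D by simp
    have "Bb * Db ^\<^sub>m Suc j = Bb * Db ^\<^sub>m j * Db"
      using assoc_mult_mat[OF B P D] by simp
    then show ?thesis
      using assoc_mult_mat_vec[OF mult_carrier_mat[OF B P] D u'(1)] by simp
  qed
  have "Db *\<^sub>v u \<in> carrier_vec c" by (rule mult_mat_vec_carrier[OF D u'(1)])
  moreover have "Bb * Db ^\<^sub>m j *\<^sub>v (Db *\<^sub>v u) = 0\<^sub>v r" if "j \<le> ?s" for j
    unfolding step using u'(2)[of "Suc j"] that by simp
  ultimately show ?thesis unfolding mat_kernel_V_mat[OF B D] by blast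
qed

section \<open>Selection of the rows of \<open>L1_mat\<close>\<close>

lemma keep_rows_basis:
  assumes "set kept \<subseteq> carrier_vec d" "set rs \<subseteq> carrier_vec d"
    and "distinct kept" "\<not> vec_lin_dep d (set kept)"
  shows "distinct (keep_rows d kept rs) \<and> \<not> vec_lin_dep d (set (keep_rows d kept rs)) \<and>
    set (keep_rows d kept rs) \<subseteq> set kept \<union> set rs \<and>
    set kept \<union> set rs \<subseteq> vec_span d (set (keep_rows d kept rs))"
  using assms
proof (induction rs arbitrary: kept)
  case Nil
  interpret vec_space "TYPE(real)" d .
  show ?case using Nil in_own_span[of "set kept"] by simp
next
  case (Cons r rs)
  interpret vec_space "TYPE(real)" d .
  define kept' where "kept' = (if r \<in> span (set kept) then kept else kept @ [r])"
  define K where "K = keep_rows d kept' rs"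
  have K: "keep_rows d kept (r # rs) = K" by (simp add: K_def kept'_def)
  \<comment> \<open>Independence is stated for sets and cannot see a repetition, so distinctness of
    the kept list is carried along; a repeated row lies in the span and is dropped.\<close>
  have "r \<notin> set kept" if "r \<notin> span (set kept)"
    using that in_own_span[of "set kept"] Cons.prems(1) by auto
  then have "distinct kept'" "\<not> lin_dep (set kept')"
    using Cons.prems lin_dep_iff_in_span[of "set kept" r] by (auto simp: kept'_def)
  moreover have c: "set kept' \<subseteq> carrier_vec d" "set rs \<subseteq> carrier_vec d"
    using Cons.prems by (auto simp: kept'_def)
  ultimately have IH: "distinct K" "\<not> lin_dep (set K)" "set K \<subseteq> set kept' \<union> set rs"
    "set kept' \<union> set rs \<subseteq> span (set K)"
    using Cons.IH[of kept'] unfolding K_def by blast+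
  \<comment> \<open>A dropped row lies in the span of the rows kept at that moment, hence also in
    the span of the final selection.\<close>
  have "span (set kept) \<subseteq> span (set K)"
  proof (rule span_subsetI)
    show "set K \<subseteq> carrier_vec d" using IH(3) c by blast
    show "set kept \<subseteq> span (set K)" using IH(4) by (auto simp: kept'_def split: if_splits)
  qed
  moreover have "set kept' \<subseteq> insert r (set kept)" "set kept \<subseteq> set kept'"
    "r \<in> span (set kept) \<or> r \<in> set kept'"
    by (auto simp: kept'_def)
  ultimately show ?case unfolding K using IH by auto
qed

text \<open>The vectors orthogonal to \<open>u\<close> form a subspace. Consequently, removing
  dependent rows does not change the kernel of a matrix.\<close>

lemma span_orthogonal:
  assumes S: "S \<subseteq> carrier_vec d" and u: "u \<in> carrier_vec d"
    and orth: "\<And>r. r \<in> S \<Longrightarrow> r \<bullet> u = 0" and v: "v \<in> vec_span d S"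
  shows "v \<bullet> u = 0"
proof -
  interpret vec_space "TYPE(real)" d .
  have "submodule class_ring {v \<in> carrier_vec d. v \<bullet> u = 0} (module_vec TYPE(real) d)"
    by unfold_locales (use u in \<open>auto simp: module_vec_simps class_ring_simps
        add_scalar_prod_distrib[of _ d]\<close>)
  from span_is_subset[OF _ this] have "span S \<subseteq> {v \<in> carrier_vec d. v \<bullet> u = 0}"
    using S orth by blast
  then show ?thesis using v by blast
qed

lemma independent_columns_injective:
  fixes M :: "real mat"
  assumes M: "M \<in> carrier_mat nr nc" and "distinct (cols M)" "\<not> vec_lin_dep nr (set (cols M))"
    and v: "v \<in> carrier_vec nc" "M *\<^sub>v v = 0\<^sub>v nr"
  shows "v = 0\<^sub>v nc"
  using vec_space.lin_depI[OF M v(1) _ v(2)] assms(2,3) by blast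

text \<open>The Gram matrix of independent rows is invertible, so such a matrix maps onto the whole
  space and its rank is the number of its rows.\<close>

lemma mat_rank_independent_rows:
  fixes L :: "real mat"
  assumes L: "L \<in> carrier_mat p c" and dist: "distinct (rows L)"
    and li: "\<not> vec_lin_dep c (set (rows L))"
  shows "mat_rank L = p"
proof -
  interpret vec_space "TYPE(real)" p .
  let ?G = "L * L\<^sup>T"
  have G: "?G \<in> carrier_mat p p" and LT: "L\<^sup>T \<in> carrier_mat c p" using L by auto
  have "v = 0\<^sub>v p" if v: "v \<in> carrier_vec p" and Gv: "?G *\<^sub>v v = 0\<^sub>v p" for v
  proof (rule independent_columns_injective[OF LT _ _ v])
    let ?w = "L\<^sup>T *\<^sub>v v"
    have w: "?w \<in> carrier_vec c" by (rule mult_mat_vec_carrier[OF LT v])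
    have "?w \<bullet> ?w = v \<bullet> (L *\<^sub>v ?w)"
      using transpose_vec_mult_scalar[OF L w v] by simp
    also have "L *\<^sub>v ?w = 0\<^sub>v p"
      using Gv assoc_mult_mat_vec[OF L LT v] by simp
    finally have "?w \<bullet> ?w = 0" using v by simp
    then have "?w = 0\<^sub>v c"
      using conjugate_square_eq_0_vec[OF w] by simp
    then show "?w = 0\<^sub>v c" .
  qed (use dist li in simp_all)
  then have "det ?G \<noteq> 0" using det_0_iff_vec_prod_zero_field[OF G] by blast
  then obtain H where H: "H \<in> carrier_mat p p" "?G * H = 1\<^sub>m p"
    using det_non_zero_imp_unit[OF G] unfolding Units_def ring_mat_def by auto
  have "carrier_vec p \<subseteq> col_space L"
  proof
    fix v :: "real vec" assume v: "v \<in> carrier_vec p"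
    have Hv: "H *\<^sub>v v \<in> carrier_vec p" by (rule mult_mat_vec_carrier[OF H(1) v])
    have "L *\<^sub>v (L\<^sup>T *\<^sub>v (H *\<^sub>v v)) = (?G * H) *\<^sub>v v"
      unfolding assoc_mult_mat_vec[OF G H(1) v] assoc_mult_mat_vec[OF L LT Hv] ..
    also have "\<dots> = v" unfolding H(2) using v by simp
    finally show "v \<in> col_space L"
      unfolding col_space_eq[OF L] using L v mult_mat_vec_carrier[OF LT Hv]
      by (auto intro!: bexI[of _ "L\<^sup>T *\<^sub>v (H *\<^sub>v v)"])
  qed
  then have "col_space L = carrier_vec p"
    unfolding col_space_eq[OF L] using L by auto
  then show ?thesis
    using L dim_is_n by (simp add: mat_rank_def rank_def col_space_def module_vec_def)
qed

text \<open>Removing dependent rows keeps the kernel, so \<open>L\<close> has the same rank as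
  \<open>V\<close>, namely \<open>h_rank Bb Db\<close>; since the kept rows are independent, this
  rank is also their number.\<close>

lemma L1_mat_properties:
  fixes Bb Db :: "real mat"
  assumes B: "Bb \<in> carrier_mat r c" and D: "Db \<in> carrier_mat c c"
  defines "L \<equiv> L1_mat Bb Db" and "V \<equiv> V_mat Bb Db (s_index Bb Db)"
  shows "L \<in> carrier_mat (h_rank Bb Db) c" "mat_kernel L = mat_kernel V" "set (rows L) \<subseteq> set (rows V)"
proof -
  interpret vec_space "TYPE(real)" c .
  have V: "V \<in> carrier_mat (Suc (s_index Bb Db) * r) c"
    unfolding V_def by (rule V_mat_carrier[OF B D])
  define ks where "ks = keep_rows c [] (rows V)"
  have rowsV: "set (rows V) \<subseteq> carrier_vec c" using V rows_carrier by blast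
  have ks: "distinct ks" "\<not> lin_dep (set ks)" "set ks \<subseteq> set (rows V)" "set (rows V) \<subseteq> span (set ks)"
    using keep_rows_basis[of "[]" c "rows V", folded ks_def] rowsV by (auto simp: lin_dep_def)
  have L_eq: "L = mat_of_rows c ks" unfolding L_def L1_mat_def ks_def V_def using B by simp
  have ksc: "set ks \<subseteq> carrier_vec c" using ks(3) rowsV by blast
  have rowsL: "rows L = ks" unfolding L_eq using ksc by simp
  have L: "L \<in> carrier_mat (length ks) c" unfolding L_eq by simp
  show "set (rows L) \<subseteq> set (rows V)" using ks rowsL by simp
  show ker: "mat_kernel L = mat_kernel V"
    unfolding mat_kernel[OF L] mat_kernel[OF V] mult_mat_vec_eq_zero_iff[OF L]
      mult_mat_vec_eq_zero_iff[OF V] rowsL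
    using ks(3,4) span_orthogonal[OF ksc] by blast
  have "mat_rank L = length ks"
    using mat_rank_independent_rows[OF L] ks rowsL by simp
  moreover have "mat_rank L = mat_rank V"
    using rank_nullity_mat[OF L] rank_nullity_mat[OF V] kernel_dim_mono(1)[OF L V]
      kernel_dim_mono(1)[OF V L] ker by simp
  ultimately show "L \<in> carrier_mat (h_rank Bb Db) c"
    using L unfolding h_rank_def V_def by simp
qed

section \<open>The right inverse \<open>L3_mat\<close> and the quotient dynamics\<close>

lemma L1_L3:
  fixes L :: "real mat"
  assumes L: "L \<in> carrier_mat h c" and cs: "independent_columns h L cs"
  shows "L3_mat L cs \<in> carrier_mat c h" "L * L3_mat L cs = 1\<^sub>m h"
proof -
  have len: "length cs = h" and sub: "set cs \<subseteq> {..<c}" and dist: "distinct (map (col L) cs)"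
    and li: "\<not> vec_lin_dep h (set (map (col L) cs))"
    using cs L unfolding independent_columns_def by auto
  have dcs: "distinct cs" using dist by (simp add: distinct_map)
  define L2 where "L2 = L2_mat L cs"
  have L2: "L2 \<in> carrier_mat h h" unfolding L2_def L2_mat_def using L len by auto
  have colsL2: "cols L2 = map (col L) cs"
    unfolding L2_def L2_mat_def using L by (intro cols_mat_of_cols) auto
  have "det L2 \<noteq> 0"
    using det_0_iff_vec_prod_zero_field[OF L2] independent_columns_injective[OF L2] dist li colsL2
    by auto
  then have "L2 \<in> Units (ring_mat TYPE(real) h ())" by (rule det_non_zero_imp_unit[OF L2])
  then obtain J where J: "mat_inverse L2 = Some J"
    using mat_inverse(1)[OF L2, of "()"] by (cases "mat_inverse L2") auto
  have J': "L2 * J = 1\<^sub>m h" "J \<in> carrier_mat h h" using mat_inverse(2)[OF L2 J] by auto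
  show c3: "L3_mat L cs \<in> carrier_mat c h" unfolding L3_mat_def using L len by simp
  \<comment> \<open>Distinct columns have distinct indices, so the position that \<open>THE\<close>
    recovers in \<open>L3_mat\<close> is unique.\<close>
  have the: "(THE j. j < length cs \<and> cs ! j = cs ! i) = i" if "i < h" for i
    using that dcs len by (intro the_equality) (auto simp: nth_eq_iff_index_eq)
  show "L * L3_mat L cs = 1\<^sub>m h"
  proof (rule eq_matI)
    fix a b assume "a < dim_row (1\<^sub>m h :: real mat)" "b < dim_col (1\<^sub>m h :: real mat)"
    then have ab: "a < h" "b < h" by simp_all
    have "(L * L3_mat L cs) $$ (a, b) = (\<Sum>q<c. L $$ (a, q) * L3_mat L cs $$ (q, b))"
      using L c3 ab by (simp add: scalar_prod_def lessThan_atLeast0)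
    \<comment> \<open>Rows of \<open>L3_mat\<close> outside \<open>cs\<close> are zero, so only the
      chosen columns of \<open>L\<close> contribute, and on them the product is that of
      \<open>L2\<close> with its inverse \<open>J\<close>.\<close>
    also have "\<dots> = (\<Sum>q\<in>set cs. L $$ (a, q) * L3_mat L cs $$ (q, b))"
      using sub L len ab by (intro sum.mono_neutral_right) (auto simp: L3_mat_def)
    also have "\<dots> = (\<Sum>i<h. L $$ (a, cs ! i) * L3_mat L cs $$ (cs ! i, b))"
      using dcs len by (intro sum.reindex_bij_betw[symmetric] bij_betw_nth) auto
    also have "\<dots> = (\<Sum>i<h. L2 $$ (a, i) * J $$ (i, b))"
    proof (intro sum.cong refl)
      fix i assume "i \<in> {..<h}"
      then have i: "i < h" by simp
      have ci: "cs ! i \<in> set cs" using i len by simp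
      then have "cs ! i < c" using sub by auto
      then show "L $$ (a, cs ! i) * L3_mat L cs $$ (cs ! i, b) = L2 $$ (a, i) * J $$ (i, b)"
        using i ab ci L len the[OF i] J
        by (simp add: L3_mat_def L2_def[symmetric]) (simp add: L2_def L2_mat_def mat_of_cols_def)
    qed
    also have "\<dots> = (L2 * J) $$ (a, b)"
      using L2 J'(2) ab by (simp add: scalar_prod_def lessThan_atLeast0)
    finally show "(L * L3_mat L cs) $$ (a, b) = 1\<^sub>m h $$ (a, b)" unfolding J'(1) .
  qed (use L c3 in auto)
qed

text \<open>Since \<open>R\<close> is a right inverse of \<open>L\<close>, the vector
  \<open>w - R (L w)\<close> lies in the kernel of \<open>L\<close>, which is that of
  \<open>V_mat\<close>. Any \<open>M\<close> vanishing on this kernel therefore factors as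
  \<open>(M * R) * L\<close>. For \<open>Bb\<close> the vanishing is the term \<open>j = 0\<close>;
  for \<open>L * Db\<close> it is the invariance of the kernel under \<open>Db\<close>.\<close>

lemma observability_quotient:
  fixes Bb Db :: "real mat"
  assumes B: "Bb \<in> carrier_mat r c" and D: "Db \<in> carrier_mat c c"
    and cs: "independent_columns (h_rank Bb Db) (L1_mat Bb Db) cs"
  defines "L \<equiv> L1_mat Bb Db" and "R \<equiv> L3_mat (L1_mat Bb Db) cs"
  shows "L * Db = (L * Db * R) * L" "Bb = (Bb * R) * L"
proof -
  let ?h = "h_rank Bb Db"
  let ?V = "V_mat Bb Db (s_index Bb Db)"
  have L: "L \<in> carrier_mat ?h c" and ker: "mat_kernel L = mat_kernel ?V"
    unfolding L_def using L1_mat_properties[OF B D] by auto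
  have R: "R \<in> carrier_mat c ?h" and LR: "L * R = 1\<^sub>m ?h"
    using L1_L3[OF _ cs] L unfolding L_def R_def by auto
  have res: "w - R *\<^sub>v (L *\<^sub>v w) \<in> mat_kernel ?V" if w: "w \<in> carrier_vec c" for w
  proof -
    have Lw: "L *\<^sub>v w \<in> carrier_vec ?h" by (rule mult_mat_vec_carrier[OF L w])
    have "L *\<^sub>v (w - R *\<^sub>v (L *\<^sub>v w)) = L *\<^sub>v w - (L * R) *\<^sub>v (L *\<^sub>v w)"
      unfolding mult_minus_distrib_mat_vec[OF L w mult_mat_vec_carrier[OF R Lw]]
        assoc_mult_mat_vec[OF L R Lw] ..
    also have "\<dots> = 0\<^sub>v ?h" unfolding LR using Lw by simp
    finally show ?thesis
      unfolding ker[symmetric] using w mult_mat_vec_carrier[OF R Lw] by (intro mat_kernelI[OF L]) auto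
  qed
  have B0: "Bb *\<^sub>v u = 0\<^sub>v r" if "u \<in> mat_kernel ?V" for u
  proof -
    have "Bb * Db ^\<^sub>m 0 *\<^sub>v u = 0\<^sub>v r" using that mat_kernel_V_mat[OF B D] by blast
    then show ?thesis using B D by simp
  qed
  have L0: "(L * Db) *\<^sub>v u = 0\<^sub>v ?h" if u: "u \<in> mat_kernel ?V" for u
  proof -
    have "Db *\<^sub>v u \<in> mat_kernel L" unfolding ker by (rule mat_kernel_V_mat_invariant[OF B D u])
    then have "L *\<^sub>v (Db *\<^sub>v u) = 0\<^sub>v ?h" using mat_kernelD[OF L] by blast
    moreover have "u \<in> carrier_vec c" using u mat_kernel_V_mat[OF B D] by blast
    ultimately show ?thesis using assoc_mult_mat_vec[OF L D] by simp
  qed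
  have factor: "M = (M * R) * L"
    if M: "M \<in> carrier_mat q c" and M0: "\<And>u. u \<in> mat_kernel ?V \<Longrightarrow> M *\<^sub>v u = 0\<^sub>v q" for M q
  proof (rule eq_matI)
    have MR: "M * R \<in> carrier_mat q ?h" by (rule mult_carrier_mat[OF M R])
    have MRL: "M * R * L \<in> carrier_mat q c" by (rule mult_carrier_mat[OF MR L])
    then show "dim_row M = dim_row (M * R * L)" "dim_col M = dim_col (M * R * L)" using M L by auto
    fix i j assume "i < dim_row (M * R * L)" "j < dim_col (M * R * L)"
    then have ij: "i < q" "j < c" using MRL M L by auto
    let ?w = "unit_vec c j :: real vec"
    have w: "?w \<in> carrier_vec c" by simp
    have Lw: "L *\<^sub>v ?w \<in> carrier_vec ?h" by (rule mult_mat_vec_carrier[OF L w])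
    have "M *\<^sub>v ?w - (M * R * L) *\<^sub>v ?w = M *\<^sub>v (?w - R *\<^sub>v (L *\<^sub>v ?w))"
      unfolding mult_minus_distrib_mat_vec[OF M w mult_mat_vec_carrier[OF R Lw]]
        assoc_mult_mat_vec[OF MR L w] assoc_mult_mat_vec[OF M R Lw] ..
    also have "\<dots> = 0\<^sub>v q" by (rule M0[OF res[OF w]])
    finally have "(M *\<^sub>v ?w) $ i - ((M * R * L) *\<^sub>v ?w) $ i = 0"
      using ij MRL M by (metis dim_mult_mat_vec carrier_matD(1) index_minus_vec(1) index_zero_vec(1))
    then show "M $$ (i, j) = (M * R * L) $$ (i, j)"
      using ij M MRL by (simp del: assoc_mult_mat index_mult_mat)
  qed
  show "L * Db = (L * Db * R) * L" using L D by (intro factor[where q = ?h] L0) auto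
  show "Bb = (Bb * R) * L" by (intro factor[OF B] B0)
qed

section \<open>The closed loop\<close>

text \<open>Vectors are plain functions here, so that one real matrix acts on real and on complex
  coordinates without \<open>map_mat\<close>; only arguments below \<open>dim_col M\<close>
  matter.\<close>

definition act :: "real mat \<Rightarrow> (nat \<Rightarrow> 'a::real_normed_field) \<Rightarrow> nat \<Rightarrow> 'a" where
  "act M v a = (\<Sum>b<dim_col M. of_real (M $$ (a, b)) * v b)"

lemma act_cong: "(\<And>b. b < dim_col M \<Longrightarrow> v b = w b) \<Longrightarrow> act M v a = act M w a"
  unfolding act_def by (intro sum.cong) auto

lemma act_diff: "act M (\<lambda>b. v b - w b) a = act M v a - act M w a"
  unfolding act_def by (simp add: right_diff_distrib sum_subtractf)

lemma act_cmult: "act M (\<lambda>b. x * v b) a = x * act M v a"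
  unfolding act_def by (simp add: sum_distrib_left mult_ac)

lemma act_zero: "act M (\<lambda>b. 0) a = 0"
  unfolding act_def by simp

lemma act_minus_mat:
  assumes "M \<in> carrier_mat nr nc" "M' \<in> carrier_mat nr nc" "a < nr"
  shows "act (M - M') v a = act M v a - act M' v a"
  using assms unfolding act_def by (simp add: left_diff_distrib sum_subtractf)

lemma act_mult:
  assumes M: "M \<in> carrier_mat nr q" and M': "M' \<in> carrier_mat q nc" and a: "a < nr"
  shows "act (M * M') v a = act M (act M' v) a"
proof -
  have "act (M * M') v a = (\<Sum>b<nc. \<Sum>j<q. of_real (M $$ (a, j)) * of_real (M' $$ (j, b)) * v b)"
    using M M' a
    by (simp add: act_def scalar_prod_def lessThan_atLeast0 sum_distrib_right del: of_real_sum)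
      (simp add: sum_distrib_right)
  also have "\<dots> = act M (act M' v) a"
    using M M' unfolding act_def by (subst sum.swap) (simp add: sum_distrib_left mult.assoc)
  finally show ?thesis .
qed

lemma act_one: "a < d \<Longrightarrow> act (1\<^sub>m d) v a = v a"
  unfolding act_def by (simp add: if_distrib if_distribR sum.delta' cong: if_cong)

lemma mult_mat_vec_act:
  assumes "M \<in> carrier_mat nr nc" "x \<in> carrier_vec nc" "a < nr"
  shows "(M *\<^sub>v x) $ a = act M (($) x) a"
  using assms by (simp add: act_def scalar_prod_def lessThan_atLeast0)

lemma norm_act_le:
  "norm (act M v a) \<le> (\<Sum>b<dim_col M. \<bar>M $$ (a, b)\<bar>) * (\<Sum>b<dim_col M. norm (v b))"
proof -
  have "norm (act M v a) \<le> (\<Sum>b<dim_col M. \<bar>M $$ (a, b)\<bar> * norm (v b))"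
    unfolding act_def by (rule order_trans[OF norm_sum]) (simp add: norm_mult)
  also have "\<dots> \<le> (\<Sum>b<dim_col M. \<bar>M $$ (a, b)\<bar> * (\<Sum>b<dim_col M. norm (v b)))"
    by (intro sum_mono mult_left_mono member_le_sum) auto
  finally show ?thesis by (simp add: sum_distrib_right)
qed

lemma act_Re: "Re (act M v a) = act M (\<lambda>b. Re (v b)) a"
  unfolding act_def by simp

lemma act_Im: "Im (act M v a) = act M (\<lambda>b. Im (v b)) a"
  unfolding act_def by simp

lemma tendsto_act_zero:
  assumes "\<And>b. b < dim_col M \<Longrightarrow> ((\<lambda>t. f t b) \<longlongrightarrow> 0) F"
  shows "((\<lambda>t. act M (f t) a) \<longlongrightarrow> 0) F"
  unfolding act_def by (intro tendsto_null_sum tendsto_mult_right_zero assms) auto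

lemma has_vector_derivative_act:
  assumes "\<And>b. b < dim_col M \<Longrightarrow> ((\<lambda>t. f t b) has_vector_derivative f' b) (at t)"
  shows "((\<lambda>t. act M (f t) a) has_vector_derivative act M f' a) (at t)"
  unfolding act_def
  by (intro has_vector_derivative_sum)
    (use has_vector_derivative_mult[OF has_vector_derivative_const assms] in auto)

lemma geometrically_bounded_act:
  assumes "\<And>b. b < dim_col M \<Longrightarrow> geometrically_bounded (\<lambda>k. c k b)"
  shows "geometrically_bounded (\<lambda>k. act M (c k) a)"
  unfolding act_def by (rule geometrically_bounded_sum) (use assms in auto)

lemma egf_act:
  assumes "\<And>b. b < dim_col M \<Longrightarrow> geometrically_bounded (\<lambda>k. c k b)"
  shows "egf (\<lambda>k. act M (c k) a) t = act M (\<lambda>b. egf (\<lambda>k. c k b) t) a"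
  unfolding act_def by (rule egf_sum) (use assms in auto)

lemma eigenvalue_act:
  assumes Q: "Q \<in> carrier_mat d d" and l: "eigenvalue (map_mat complex_of_real Q) l"
  obtains v where "\<And>a. a < d \<Longrightarrow> act Q v a = l * v a" "\<exists>a<d. v a \<noteq> 0"
proof -
  obtain v where v: "v \<in> carrier_vec d" "v \<noteq> 0\<^sub>v d" "map_mat complex_of_real Q *\<^sub>v v = l \<cdot>\<^sub>v v"
    using l Q unfolding eigenvalue_def eigenvector_def by auto
  have "act Q (($) v) a = l * v $ a" if a: "a < d" for a
  proof -
    have "act Q (($) v) a = (map_mat complex_of_real Q *\<^sub>v v) $ a"
      using Q v(1) a by (simp add: act_def scalar_prod_def lessThan_atLeast0)
    then show ?thesis unfolding v(3) using v(1) a by simp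
  qed
  moreover have "\<exists>a<d. v $ a \<noteq> 0" using v(1,2) by (auto simp: vec_eq_iff)
  ultimately show ?thesis using that by blast
qed

lemma vnorm_tendsto_zero_iff:
  fixes x :: "real \<Rightarrow> real vec"
  assumes x: "\<And>t. 0 < t \<Longrightarrow> x t \<in> carrier_vec n"
  shows "((\<lambda>t. vnorm (x t)) \<longlongrightarrow> 0) at_top \<longleftrightarrow> (\<forall>a<n. ((\<lambda>t. x t $ a) \<longlongrightarrow> 0) at_top)"
proof
  assume lim: "((\<lambda>t. vnorm (x t)) \<longlongrightarrow> 0) at_top"
  show "\<forall>a<n. ((\<lambda>t. x t $ a) \<longlongrightarrow> 0) at_top"
  proof (intro allI impI)
    fix a assume a: "a < n"
    have "eventually (\<lambda>t. norm (x t $ a) \<le> vnorm (x t)) at_top"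
      using eventually_gt_at_top[of 0]
    proof eventually_elim
      case (elim t)
      have "(x t $ a)\<^sup>2 \<le> (\<Sum>b\<in>{0..<n}. x t $ b * x t $ b)"
        using member_le_sum[of a "{0..<n}" "\<lambda>b. x t $ b * x t $ b"] a by (simp add: power2_eq_square)
      then have "sqrt ((x t $ a)\<^sup>2) \<le> vnorm (x t)"
        using x[OF elim] unfolding vnorm_def scalar_prod_def by (intro real_sqrt_le_mono) simp
      then show ?case by simp
    qed
    then have "eventually (\<lambda>t. norm (x t $ a) \<le> norm (vnorm (x t)) * 1) at_top"
      by (rule eventually_mono) simp
    then show "((\<lambda>t. x t $ a) \<longlongrightarrow> 0) at_top" by (rule tendsto_0_le[OF lim])
  qed
next
  assume lim: "\<forall>a<n. ((\<lambda>t. x t $ a) \<longlongrightarrow> 0) at_top"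
  have "((\<lambda>t. sqrt (\<Sum>b\<in>{0..<n}. x t $ b * x t $ b)) \<longlongrightarrow> sqrt 0) at_top"
    by (intro tendsto_real_sqrt tendsto_null_sum tendsto_mult_zero) (use lim in auto)
  moreover have "eventually (\<lambda>t. sqrt (\<Sum>b\<in>{0..<n}. x t $ b * x t $ b) = vnorm (x t)) at_top"
    using eventually_gt_at_top[of 0]
    by eventually_elim (simp add: vnorm_def scalar_prod_def carrier_vecD[OF x])
  ultimately show "((\<lambda>t. vnorm (x t)) \<longlongrightarrow> 0) at_top"
    using Lim_transform_eventually by fastforce
qed

lemma sum_lessThan_add:
  fixes f :: "nat \<Rightarrow> 'a::comm_monoid_add"
  shows "(\<Sum>b<n + m. f b) = (\<Sum>b<n. f b) + (\<Sum>b<m. f (n + b))"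
  by (induction m) (simp_all add: add.assoc)

lemma block_index_less:
  fixes a j n N :: nat
  assumes "j < N" "a < n"
  shows "j * n + a < N * n"
proof -
  have "j * n + a < Suc j * n" using assms by simp
  also have "\<dots> \<le> N * n" using assms by (intro mult_le_mono1) simp
  finally show ?thesis .
qed

section \<open>Closed-loop equations and disturbances\<close>

locale multi_agent_system =
  fixes N n m :: nat
    and A B G K :: "nat \<Rightarrow> real mat" and W :: "nat \<Rightarrow> nat \<Rightarrow> real mat" and p :: "nat \<Rightarrow> nat"
  assumes A: "i \<le> N \<Longrightarrow> A i \<in> carrier_mat n n"
    and B: "i \<le> N \<Longrightarrow> B i \<in> carrier_mat n m"
    and G: "i \<in> {1..N} \<Longrightarrow> G i \<in> carrier_mat m n"
    and K: "i \<in> {1..N} \<Longrightarrow> K i \<in> carrier_mat m n"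
    and W: "i \<le> N \<Longrightarrow> j \<le> N \<Longrightarrow> W i j \<in> carrier_mat n n"
    and p: "i \<in> {1..N} \<Longrightarrow> p i < i"
begin

abbreviation "As \<equiv> A_star A B G"
abbreviation "Bs \<equiv> B_star n B K W p"
abbreviation "F i \<equiv> As i - Bs i"

lemma p_le: "i \<in> {1..N} \<Longrightarrow> p i \<le> N"
  using p[of i] by auto

text \<open>Whether the parent is the leader or another follower, one of the two weights is
  \<open>W i (p i)\<close> and the other is zero.\<close>

lemma Bs_eq:
  assumes "i \<in> {1..N}"
  shows "Bs i = B i * K i * W i (p i)"
  using W[of i "p i"] p_le[OF assms] assms
  by (auto simp: B_star_def follower_weight_def leader_weight_def)

lemma As_carrier: "i \<in> {1..N} \<Longrightarrow> As i \<in> carrier_mat n n"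
  using A[of i] B[of i] G[of i] by (auto simp: A_star_def)

lemma Bs_carrier: "i \<in> {1..N} \<Longrightarrow> Bs i \<in> carrier_mat n n"
  using B[of i] K[of i] W[of i "p i"] p_le[of i] by (auto simp: Bs_eq)

lemma F_carrier: "i \<in> {1..N} \<Longrightarrow> F i \<in> carrier_mat n n"
  by (rule minus_carrier_mat[OF Bs_carrier])

text \<open>The state feedback turns \<open>A i\<close> into \<open>As i\<close>, and the coupling
  contributes \<open>Bs i\<close> applied to \<open>y - x\<close>.\<close>

lemma closed_loop_follower:
  assumes i: "i \<in> {1..N}" and x: "x \<in> carrier_vec n" and y: "y \<in> carrier_vec n" and a: "a < n"
  shows "(A i *\<^sub>v x + B i *\<^sub>v (- (G i *\<^sub>v x) + (K i * W i (p i)) *\<^sub>v (y - x))) $ a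
    = act (F i) (($) x) a + act (Bs i) (($) y) a"
proof -
  have iN: "i \<le> N" using i by simp
  note c = A[OF iN] B[OF iN] G[OF i] K[OF i] W[OF iN p_le[OF i]]
  have KW: "K i * W i (p i) \<in> carrier_mat m n" using c by auto
  have Gx: "G i *\<^sub>v x \<in> carrier_vec m" by (rule mult_mat_vec_carrier[OF c(3) x])
  have KWyx: "(K i * W i (p i)) *\<^sub>v (y - x) \<in> carrier_vec m"
    using x y by (intro mult_mat_vec_carrier[OF KW]) auto
  have yx: "y - x \<in> carrier_vec n" using x y by auto
  have u: "- (G i *\<^sub>v x) + (K i * W i (p i)) *\<^sub>v (y - x) \<in> carrier_vec m" using Gx KWyx by auto
  have "act (B i) (($) (- (G i *\<^sub>v x) + (K i * W i (p i)) *\<^sub>v (y - x))) a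
      = act (B i) (\<lambda>b. act (K i * W i (p i)) (\<lambda>j. y $ j - x $ j) b - act (G i) (($) x) b) a"
  proof (rule act_cong)
    fix b assume "b < dim_col (B i)"
    then have b: "b < m" using c by simp
    have "act (K i * W i (p i)) (($) (y - x)) b = act (K i * W i (p i)) (\<lambda>j. y $ j - x $ j) b"
      by (rule act_cong) (use KW x y in auto)
    moreover have "(- (G i *\<^sub>v x) + (K i * W i (p i)) *\<^sub>v (y - x)) $ b
        = (K i * W i (p i) *\<^sub>v (y - x)) $ b - (G i *\<^sub>v x) $ b"
      using carrier_vecD[OF Gx] carrier_vecD[OF KWyx] b by (simp del: index_mult_mat_vec)
    ultimately show "(- (G i *\<^sub>v x) + (K i * W i (p i)) *\<^sub>v (y - x)) $ b
        = act (K i * W i (p i)) (\<lambda>j. y $ j - x $ j) b - act (G i) (($) x) b"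
      using mult_mat_vec_act[OF KW yx b] mult_mat_vec_act[OF c(3) x b] by simp
  qed
  also have "\<dots> = act (B i * (K i * W i (p i))) (\<lambda>j. y $ j - x $ j) a - act (B i * G i) (($) x) a"
    by (simp only: act_diff act_mult[OF c(2) KW a] act_mult[OF c(2) c(3) a])
  also have "B i * (K i * W i (p i)) = Bs i"
    using assoc_mult_mat[OF c(2) c(4) c(5)] Bs_eq[OF i] by simp
  finally have "act (B i) (($) (- (G i *\<^sub>v x) + (K i * W i (p i)) *\<^sub>v (y - x))) a
      = act (Bs i) (($) y) a - act (Bs i) (($) x) a - act (B i * G i) (($) x) a"
    by (simp only: act_diff)
  moreover have "act (F i) (($) x) a = act (A i) (($) x) a - act (B i * G i) (($) x) a - act (Bs i) (($) x) a"
    unfolding act_minus_mat[OF As_carrier[OF i] Bs_carrier[OF i] a]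
    unfolding A_star_def act_minus_mat[OF c(1) mult_carrier_mat[OF c(2) c(3)] a] ..
  ultimately show ?thesis
    using mult_mat_vec_act[OF c(1) x a] mult_mat_vec_act[OF c(2) u a] c a by (simp del: index_mult_mat_vec)
qed

text \<open>The error of follower \<open>i\<close> relative to the leader is driven by \<open>- disturbance i\<close>; the
  blocks of \<open>B_bar\<close> applied to the leader's state and input are its increments in \<open>i\<close>.\<close>

definition disturbance :: "nat \<Rightarrow> (nat \<Rightarrow> 'a::real_normed_field) \<Rightarrow> (nat \<Rightarrow> 'a) \<Rightarrow> nat \<Rightarrow> 'a" where
  "disturbance i v u a = act (A 0) v a - act (As i) v a + act (B 0) u a"

text \<open>Since \<open>F i + Bs i = As i\<close>, passing from \<open>x\<close> and
  \<open>y\<close> to their differences with \<open>v\<close> removes exactly \<open>As i\<close>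
  applied to \<open>v\<close>; its mismatch with the leader's own motion is the disturbance.\<close>

lemma error_dynamics:
  assumes "i \<in> {1..N}" "a < n"
  shows "act (F i) x a + act (Bs i) y a - (act (A 0) v a + act (B 0) u a)
    = act (F i) (\<lambda>b. x b - v b) a + act (Bs i) (\<lambda>b. y b - v b) a - disturbance i v u a"
  unfolding disturbance_def act_diff
    act_minus_mat[OF As_carrier[OF assms(1)] Bs_carrier[OF assms(1)] assms(2)]
  by simp

definition stack :: "(nat \<Rightarrow> 'a) \<Rightarrow> (nat \<Rightarrow> 'a) \<Rightarrow> nat \<Rightarrow> 'a" where
  "stack v u b = (if b < n then v b else u (b - n))"

abbreviation "Bb \<equiv> B_bar N n m A B G"
abbreviation "Db \<equiv> D_bar n m A B"

lemma Bb_carrier: "Bb \<in> carrier_mat (N * n) (n + m)"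
  by (simp add: B_bar_def)

lemma Db_carrier: "Db \<in> carrier_mat (n + m) (n + m)"
  using A[of 0] B[of 0] by (auto simp: D_bar_def)

text \<open>The last \<open>m\<close> rows of \<open>Db\<close> are zero, which expresses that the
  leader's input is constant.\<close>

lemma act_Db_stack:
  assumes "b < n + m"
  shows "act Db (stack v u) b = stack (\<lambda>a. act (A 0) v a + act (B 0) u a) (\<lambda>_. 0) b"
proof -
  have "act Db (stack v u) b = (\<Sum>j<n. of_real (Db $$ (b, j)) * v j) + (\<Sum>j<m. of_real (Db $$ (b, n + j)) * u j)"
    using Db_carrier by (simp add: act_def sum_lessThan_add stack_def)
  then show ?thesis
    using assms A[of 0] B[of 0] by (auto simp: D_bar_def act_def stack_def)
qed

text \<open>The blocks telescope: \<open>A 0\<close> and \<open>B 0\<close> occur only in the first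
  one, and each later block is a difference of two consecutive \<open>As\<close>. Rows are counted
  from 0, so row \<open>j * n + a\<close> lies in the block numbered \<open>Suc j\<close>.\<close>

lemma act_Bb_stack:
  assumes j: "j < N" and a: "a < n"
  shows "act Bb (stack v u) (j * n + a)
    = disturbance (Suc j) v u a - (if j = 0 then 0 else disturbance j v u a)"
proof -
  have r: "j * n + a < N * n" "(j * n + a) div n = j" "(j * n + a) mod n = a"
    using block_index_less[OF j a] a by auto
  have c: "A 0 \<in> carrier_mat n n" "B 0 \<in> carrier_mat n m" "As (Suc j) \<in> carrier_mat n n"
    using A[of 0] B[of 0] As_carrier[of "Suc j"] j by auto
  have blk: "of_real (A_hat_block A B G (Suc j) $$ (a, b)) = (if j = 0
      then of_real (A 0 $$ (a, b)) - of_real (As (Suc j) $$ (a, b))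
      else of_real (As j $$ (a, b)) - of_real (As (Suc j) $$ (a, b)) :: 'a)" if b: "b < n" for b
  proof -
    have "Suc j \<in> {1..N}" "Suc j \<le> N" using j by auto
    note c' = A[OF this(2)] B[OF this(2)] G[OF this(1)]
    show ?thesis
    proof (cases "j = 0")
      case True
      then show ?thesis using c(1) c' a b by (simp add: A_hat_block_def A_star_def)
    next
      case False
      then have "j \<in> {1..N}" "j \<le> N" using j by auto
      note c'' = A[OF this(2)] B[OF this(2)] G[OF this(1)]
      show ?thesis using False c'' c' a b by (simp add: A_hat_block_def A_star_def)
    qed
  qed
  have "act Bb (stack v u) (j * n + a)
      = (\<Sum>b<n. of_real (A_hat_block A B G (Suc j) $$ (a, b)) * v b)
        + (\<Sum>b<m. of_real (if j = 0 then B 0 $$ (a, b) else 0) * u b)"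
  proof -
    have "j * n + a < n \<longleftrightarrow> j = 0" using a by (cases j) auto
    then show ?thesis
      using r a by (cases "j = 0")
        (simp_all add: act_def B_bar_def A_hat_def B_hat_def sum_lessThan_add stack_def)
  qed
  also have "\<dots> = disturbance (Suc j) v u a - (if j = 0 then 0 else disturbance j v u a)"
  proof (cases "j = 0")
    case True
    then show ?thesis
      using c blk by (simp add: disturbance_def act_def left_diff_distrib sum_subtractf)
  next
    case False
    then have "As j \<in> carrier_mat n n" using As_carrier[of j] j by auto
    then show ?thesis
      using False c blk by (simp add: disturbance_def act_def left_diff_distrib sum_subtractf)
  qed
  finally show ?thesis .
qed

lemma trajectory_derivative:
  assumes tr: "closed_loop_trajectory N n m A B G K W p u0 x u" and u0: "u0 \<in> carrier_vec m"
    and t: "0 < t" and a: "a < n"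
  shows "((\<lambda>\<tau>. x 0 \<tau> $ a) has_real_derivative act (A 0) (($) (x 0 t)) a + act (B 0) (($) u0) a) (at t)"
    and "i \<in> {1..N} \<Longrightarrow> ((\<lambda>\<tau>. x i \<tau> $ a) has_real_derivative
      act (F i) (($) (x i t)) a + act (Bs i) (($) (x (p i) t)) a) (at t)"
proof -
  \<comment> \<open>For positive \<open>t\<close> the derivative within \<open>{0..}\<close> is an
    ordinary two-sided one.\<close>
  have at: "at t within {0..} = at t" using t by (intro at_within_open_subset[of t "{0<..}"]) auto
  have x: "x i t \<in> carrier_vec n" if "i \<le> N" for i
    using tr that t unfolding closed_loop_trajectory_def by simp
  have d: "((\<lambda>\<tau>. x i \<tau> $ a) has_real_derivative (A i *\<^sub>v x i t + B i *\<^sub>v u i t) $ a) (at t)"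
    if "i \<le> N" for i
    using tr that t a unfolding closed_loop_trajectory_def has_vec_derivative_def at[symmetric] by simp
  have "u 0 t = u0" using tr t unfolding closed_loop_trajectory_def by simp
  then show "((\<lambda>\<tau>. x 0 \<tau> $ a) has_real_derivative act (A 0) (($) (x 0 t)) a + act (B 0) (($) u0) a) (at t)"
    using d[of 0] mult_mat_vec_act[OF A x a, of 0] mult_mat_vec_act[OF B u0 a, of 0] B[of 0] a
    by (simp del: index_mult_mat_vec)
  assume i: "i \<in> {1..N}"
  then have "u i t = - (G i *\<^sub>v x i t) + (K i * W i (p i)) *\<^sub>v (x (p i) t - x i t)"
    using tr t unfolding closed_loop_trajectory_def by simp
  then show "((\<lambda>\<tau>. x i \<tau> $ a) has_real_derivative
      act (F i) (($) (x i t)) a + act (Bs i) (($) (x (p i) t)) a) (at t)"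
    using d[of i] closed_loop_follower[OF i x x[OF p_le[OF i]] a] i by simp
qed

text \<open>Needed for the necessity direction: solutions of the coordinate equations on the whole
  line become a closed-loop trajectory once the protocol inputs are attached.\<close>

lemma trajectoryI:
  fixes X :: "nat \<Rightarrow> nat \<Rightarrow> real \<Rightarrow> real"
  assumes u0: "u0 \<in> carrier_vec m"
    and X0: "\<And>a t. a < n \<Longrightarrow> (X 0 a has_real_derivative act (A 0) (\<lambda>b. X 0 b t) a + act (B 0) (($) u0) a) (at t)"
    and X: "\<And>i a t. i \<in> {1..N} \<Longrightarrow> a < n \<Longrightarrow>
      (X i a has_real_derivative act (F i) (\<lambda>b. X i b t) a + act (Bs i) (\<lambda>b. X (p i) b t) a) (at t)"
  defines "x \<equiv> \<lambda>i t. vec n (\<lambda>a. X i a t)"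
  shows "closed_loop_trajectory N n m A B G K W p u0 x
    (\<lambda>i t. if i = 0 then u0 else - (G i *\<^sub>v x i t) + (K i * W i (p i)) *\<^sub>v (x (p i) t - x i t))"
    (is "closed_loop_trajectory _ _ _ _ _ _ _ _ _ _ _ ?u")
proof -
  have x: "x i t \<in> carrier_vec n" for i t by (simp add: x_def)
  have act_x: "act M (($) (x i t)) a = act M (\<lambda>b. X i b t) a" if "M \<in> carrier_mat n n" for M i t a
    by (rule act_cong) (use that in \<open>auto simp: x_def\<close>)
  have u: "?u i t \<in> carrier_vec m" if "i \<le> N" for i t
  proof (cases "i = 0")
    case False
    then have i: "i \<in> {1..N}" using that by simp
    have "G i *\<^sub>v x i t \<in> carrier_vec m" by (rule mult_mat_vec_carrier[OF G[OF i] x])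
    moreover have "(K i * W i (p i)) *\<^sub>v (x (p i) t - x i t) \<in> carrier_vec m"
      by (rule mult_mat_vec_carrier[OF mult_carrier_mat[OF K[OF i] W[OF that p_le[OF i]]]
            minus_carrier_vec[OF x x]])
    ultimately show ?thesis using False by simp
  qed (use u0 in simp)
  have "has_vec_derivative n (x i) (A i *\<^sub>v x i t + B i *\<^sub>v ?u i t) t" if iN: "i \<le> N" for i t
    unfolding has_vec_derivative_def
  proof (intro allI impI)
    fix a assume a: "a < n"
    have eq: "(\<lambda>\<tau>. x i \<tau> $ a) = X i a" using a by (simp add: x_def)
    show "((\<lambda>\<tau>. x i \<tau> $ a) has_real_derivative (A i *\<^sub>v x i t + B i *\<^sub>v ?u i t) $ a) (at t within {0..})"
      unfolding eq
    proof (rule has_field_derivative_at_within, cases "i = 0")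
      case True
      then show "(X i a has_real_derivative (A i *\<^sub>v x i t + B i *\<^sub>v ?u i t) $ a) (at t)"
        using X0[OF a, of t] mult_mat_vec_act[OF A x a, of 0 0 t] mult_mat_vec_act[OF B u0 a, of 0]
          act_x[OF A, of 0 0 t a] B[of 0] a
        by (simp del: index_mult_mat_vec)
    next
      case False
      then have i: "i \<in> {1..N}" using iN by simp
      show "(X i a has_real_derivative (A i *\<^sub>v x i t + B i *\<^sub>v ?u i t) $ a) (at t)"
        using X[OF i a, of t] closed_loop_follower[OF i x[of i t] x[of "p i" t] a] i
          act_x[OF F_carrier[OF i], of i t a] act_x[OF Bs_carrier[OF i], of "p i" t a]
        by simp
    qed
  qed
  with x u show ?thesis
    unfolding closed_loop_trajectory_def by (intro conjI ballI allI impI) (blast | simp)+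
qed

section \<open>Sufficiency of the Hurwitz conditions\<close>

abbreviation "L \<equiv> L1_mat Bb Db"

text \<open>The rows of \<open>Bb\<close> give the increments of the disturbances in
  \<open>i\<close>, and finitely many vanishing increments add up to a vanishing sum.\<close>

lemma disturbance_tendsto_zero:
  fixes v u :: "real \<Rightarrow> nat \<Rightarrow> real"
  assumes Bb0: "\<And>r. r < N * n \<Longrightarrow> ((\<lambda>t. act Bb (stack (v t) (u t)) r) \<longlongrightarrow> 0) at_top"
    and a: "a < n"
  shows "i \<in> {1..N} \<Longrightarrow> ((\<lambda>t. disturbance i (v t) (u t) a) \<longlongrightarrow> 0) at_top"
proof (induction i)
  case (Suc j)
  then have j: "j < N" by simp
  note r = block_index_less[OF j a]
  have eq: "disturbance (Suc j) (v t) (u t) a = act Bb (stack (v t) (u t)) (j * n + a)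
      + (if j = 0 then 0 else disturbance j (v t) (u t) a)" for t
    using act_Bb_stack[OF j a, of "v t" "u t"] by simp
  have "((\<lambda>t. if j = 0 then 0 else disturbance j (v t) (u t) a) \<longlongrightarrow> 0) at_top"
    using Suc.IH j by (cases "j = 0") auto
  from tendsto_add[OF Bb0[OF r] this] show ?case unfolding eq by simp
qed simp

lemma consensus_if_hurwitz:
  assumes cs: "independent_columns (h_rank Bb Db) L cs"
    and F: "\<And>i. i \<in> {1..N} \<Longrightarrow> hurwitz (F i)"
    and Q: "hurwitz (L * Db * L3_mat L cs)"
  shows "leader_following_consensus N n m A B G K W p"
  unfolding leader_following_consensus_def
proof (intro ballI allI impI)
  fix u0 x u i
  assume u0: "u0 \<in> carrier_vec m" and tr: "closed_loop_trajectory N n m A B G K W p u0 x u"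
    and i: "i \<in> {1..N}"
  let ?h = "h_rank Bb Db"
  let ?R = "L3_mat L cs"
  let ?Q = "L * Db * ?R"
  let ?v = "\<lambda>t. ($) (x 0 t)" and ?u = "($) u0"
  have L: "L \<in> carrier_mat ?h (n + m)" by (rule L1_mat_properties(1)[OF Bb_carrier Db_carrier])
  have R: "?R \<in> carrier_mat (n + m) ?h" by (rule L1_L3(1)[OF L cs])
  have LD: "L * Db \<in> carrier_mat ?h (n + m)" by (rule mult_carrier_mat[OF L Db_carrier])
  have Qc: "?Q \<in> carrier_mat ?h ?h" by (rule mult_carrier_mat[OF LD R])
  note quot = observability_quotient[OF Bb_carrier Db_carrier cs]
  note der = trajectory_derivative[OF tr u0]
  let ?y = "\<lambda>a t. act L (stack (?v t) ?u) a"
  \<comment> \<open>Because \<open>L * Db\<close> factors through \<open>L\<close>, the observed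
    coordinates obey a closed equation with matrix \<open>?Q\<close> and zero input.\<close>
  have y: "(?y a \<longlongrightarrow> 0) at_top" if a: "a < ?h" for a
  proof (rule input_to_state_stable[OF Qc Q _ _ a, where f = "\<lambda>_ _. 0"])
    fix b and t :: real assume b: "b < ?h" and t: "0 < t"
    have z: "((\<lambda>t. stack (?v t) ?u j) has_vector_derivative act Db (stack (?v t) ?u) j) (at t)"
      if "j < dim_col L" for j
    proof -
      have j: "j < n + m" using that L by simp
      show ?thesis
        unfolding act_Db_stack[OF j] stack_def
        using der(1)[OF t, of j] by (simp add: has_real_derivative_iff_has_vector_derivative)
    qed
    have "(?y b has_vector_derivative act L (act Db (stack (?v t) ?u)) b) (at t)"
      by (rule has_vector_derivative_act[OF z])
    also have "act L (act Db (stack (?v t) ?u)) b = act (L * Db) (stack (?v t) ?u) b"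
      by (rule act_mult[OF L Db_carrier b, symmetric])
    also have "\<dots> = act ?Q (act L (stack (?v t) ?u)) b"
      by (subst quot(1)) (rule act_mult[OF Qc L b])
    finally show "(?y b has_real_derivative (\<Sum>j<?h. ?Q $$ (b, j) * ?y j t) + 0) (at t)"
      unfolding act_def[of ?Q] carrier_matD(2)[OF Qc]
      by (simp add: has_real_derivative_iff_has_vector_derivative)
  qed simp
  have BR: "Bb * ?R \<in> carrier_mat (N * n) ?h" by (rule mult_carrier_mat[OF Bb_carrier R])
  \<comment> \<open>Also \<open>Bb\<close> factors through \<open>L\<close>, so the increments of
    the disturbances are fixed linear functions of \<open>y\<close> and decay with it.\<close>
  have "((\<lambda>t. act Bb (stack (?v t) ?u) r) \<longlongrightarrow> 0) at_top" if r: "r < N * n" for r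
  proof -
    have "act Bb (stack (?v t) ?u) r = act (Bb * ?R) (act L (stack (?v t) ?u)) r" for t
      by (subst quot(2)) (rule act_mult[OF BR L r])
    then show ?thesis
      by (simp only:) (rule tendsto_act_zero, simp only: carrier_matD(2)[OF BR] y)
  qed
  note w = disturbance_tendsto_zero[of ?v "\<lambda>_. ?u", OF this]
  \<comment> \<open>The parent has a smaller index, so its error already tends to 0 when follower
    \<open>i\<close> is reached; this error and the disturbance form a vanishing input to the stable
    matrix \<open>F i\<close>. The leader's own error is 0.\<close>
  have e: "i \<le> N \<Longrightarrow> \<forall>a<n. ((\<lambda>t. x i t $ a - x 0 t $ a) \<longlongrightarrow> 0) at_top" for i
  proof (induction i rule: less_induct)
    case (less i)
    show ?case
    proof (cases "i = 0")
      case False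
      with less.prems have i: "i \<in> {1..N}" by simp
      have ep: "((\<lambda>t. x (p i) t $ a - x 0 t $ a) \<longlongrightarrow> 0) at_top" if "a < n" for a
        using less.IH[OF p[OF i] p_le[OF i]] that by blast
      show ?thesis
      proof (intro allI impI)
        fix a assume a: "a < n"
        let ?f = "\<lambda>a t. act (Bs i) (\<lambda>b. x (p i) t $ b - x 0 t $ b) a - disturbance i (?v t) ?u a"
        show "((\<lambda>t. x i t $ a - x 0 t $ a) \<longlongrightarrow> 0) at_top"
        proof (rule input_to_state_stable[OF F_carrier[OF i] F[OF i] _ _ a, where f = ?f])
          fix b and t :: real assume b: "b < n" and t: "0 < t"
          have "((\<lambda>t. x i t $ b - x 0 t $ b) has_real_derivative
              act (F i) (($) (x i t)) b + act (Bs i) (($) (x (p i) t)) b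
              - (act (A 0) (?v t) b + act (B 0) ?u b)) (at t)"
            by (rule DERIV_diff[OF der(2)[OF t b i] der(1)[OF t b]])
          then show "((\<lambda>t. x i t $ b - x 0 t $ b) has_real_derivative
              (\<Sum>j<n. F i $$ (b, j) * (x i t $ j - x 0 t $ j)) + ?f b t) (at t)"
            unfolding error_dynamics[OF i b]
            unfolding act_def[of "F i"] carrier_matD(2)[OF F_carrier[OF i]]
            by (simp only: of_real_eq_id id_apply add_diff_eq)
        next
          fix b assume b: "b < n"
          have "((\<lambda>t. act (Bs i) (\<lambda>b. x (p i) t $ b - x 0 t $ b) b) \<longlongrightarrow> 0) at_top"
            using ep Bs_carrier[OF i] by (intro tendsto_act_zero) auto
          from tendsto_diff[OF this w[OF _ b i]] show "(?f b \<longlongrightarrow> 0) at_top" by simp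
        qed
      qed
    qed simp
  qed
  have xc: "x j t \<in> carrier_vec n" if "0 < t" "j \<le> N" for j t
    using tr that unfolding closed_loop_trajectory_def by simp
  have "((\<lambda>t. (x i t - x 0 t) $ a) \<longlongrightarrow> 0) at_top" if a: "a < n" for a
  proof (rule Lim_transform_eventually)
    show "((\<lambda>t. x i t $ a - x 0 t $ a) \<longlongrightarrow> 0) at_top" using e[of i] i a by simp
    show "eventually (\<lambda>t. x i t $ a - x 0 t $ a = (x i t - x 0 t) $ a) at_top"
      using eventually_gt_at_top[of 0] by eventually_elim (simp add: a carrier_vecD[OF xc])
  qed
  then show "((\<lambda>t. vnorm (x i t - x 0 t)) \<longlongrightarrow> 0) at_top"
    using i xc by (subst vnorm_tendsto_zero_iff[of _ n]) auto
qed

text \<open>The entry \<open>c k i a\<close> stands for the k-th derivative at 0 of component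
  \<open>a\<close> of agent \<open>i\<close>. A constant input enters only the first derivative of
  the leader directly, hence the case \<open>k = 0\<close>.\<close>

definition coefficient_family ::
  "(nat \<Rightarrow> nat \<Rightarrow> nat \<Rightarrow> 'a::real_normed_field) \<Rightarrow> (nat \<Rightarrow> 'a) \<Rightarrow> bool" where
  "coefficient_family c u \<longleftrightarrow> (\<forall>k. \<forall>a<n.
     c (Suc k) 0 a = act (A 0) (c k 0) a + act (B 0) (\<lambda>b. if k = 0 then u b else 0) a \<and>
     (\<forall>i\<in>{1..N}. c (Suc k) i a = act (F i) (c k i) a + act (Bs i) (c k (p i)) a))"

lemma coefficient_familyD:
  assumes "coefficient_family c u" "a < n"
  shows "c (Suc k) 0 a = act (A 0) (c k 0) a + act (B 0) (\<lambda>b. if k = 0 then u b else 0) a"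
    and "i \<in> {1..N} \<Longrightarrow> c (Suc k) i a = act (F i) (c k i) a + act (Bs i) (c k (p i)) a"
  using assms unfolding coefficient_family_def by blast+

lemma coefficient_family_exists:
  obtains c where "c 0 = c0" "coefficient_family c u"
proof -
  define c where "c = rec_nat c0 (\<lambda>k ck i a. if i = 0
    then act (A 0) (ck 0) a + act (B 0) (\<lambda>b. if k = 0 then u b else 0) a
    else act (F i) (ck i) a + act (Bs i) (ck (p i)) a)"
  have "c 0 = c0" by (simp add: c_def)
  moreover have "coefficient_family c u" by (simp add: coefficient_family_def c_def)
  ultimately show ?thesis by (rule that)
qed

text \<open>Adjoining the input as a fictitious agent \<open>Suc N\<close> that is 0 from the second
  coefficient on makes the recurrence homogeneous over one finite index set; row sums of absolute
  values then bound each step.\<close>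

lemma geometrically_bounded_coefficient_family:
  assumes c: "coefficient_family c u" and i: "i \<le> N" and a: "a < n"
  shows "geometrically_bounded (\<lambda>k. c k i a)"
proof -
  define I where "I = {..N} \<times> {..<n} \<union> {Suc N} \<times> {..<m}"
  define C where "C k q = (if fst q \<le> N then c k (fst q) (snd q) else if k = 0 then u (snd q) else 0)"
    for k :: nat and q
  define \<sigma> where "\<sigma> M a = (\<Sum>b<dim_col M. \<bar>M $$ (a, b)\<bar>)" for M :: "real mat" and a
  define \<beta> where "\<beta> q = (if fst q = 0 then \<sigma> (A 0) (snd q) + \<sigma> (B 0) (snd q)
    else \<sigma> (F (fst q)) (snd q) + \<sigma> (Bs (fst q)) (snd q))" for q
  have \<sigma>0: "0 \<le> \<sigma> M a" for M a by (simp add: \<sigma>_def sum_nonneg)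
  then have \<beta>0: "0 \<le> \<beta> q" for q by (simp add: \<beta>_def)
  have fin: "finite I" by (simp add: I_def)
  have sub: "(\<Sum>b<d. norm (C k (j, b))) \<le> (\<Sum>q\<in>I. norm (C k q))" if "{j} \<times> {..<d} \<subseteq> I" for d j k
  proof -
    have "(\<Sum>b<d. norm (C k (j, b))) = (\<Sum>q\<in>{j} \<times> {..<d}. norm (C k q))"
      by (subst sum.reindex[of "Pair j" "{..<d}", unfolded o_def, symmetric])
        (auto simp: inj_on_def intro!: sum.cong)
    also have "\<dots> \<le> (\<Sum>q\<in>I. norm (C k q))" by (intro sum_mono2 fin that) auto
    finally show ?thesis .
  qed
  have act_le: "norm (act M v a) \<le> \<sigma> M a * (\<Sum>q\<in>I. norm (C k q))"
    if "(\<Sum>b<dim_col M. norm (v b)) \<le> (\<Sum>q\<in>I. norm (C k q))" for M v a k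
    unfolding \<sigma>_def by (rule order_trans[OF norm_act_le mult_left_mono[OF that]]) (simp add: sum_nonneg)
  have agent: "(\<Sum>b<n. norm (c k j b)) \<le> (\<Sum>q\<in>I. norm (C k q))" if "j \<le> N" for j k
  proof -
    have "{j} \<times> {..<n} \<subseteq> I" "\<And>b. C k (j, b) = c k j b" using that by (auto simp: I_def C_def)
    then show ?thesis using sub[of j n k] by simp
  qed
  have input: "(\<Sum>b<m. norm (if k = 0 then u b else 0)) \<le> (\<Sum>q\<in>I. norm (C k q))" for k
  proof -
    have "{Suc N} \<times> {..<m} \<subseteq> I" "\<And>b. C k (Suc N, b) = (if k = 0 then u b else 0)"
      by (auto simp: I_def C_def)
    then show ?thesis using sub[of "Suc N" m k] by simp
  qed
  have step: "norm (C (Suc k) q) \<le> (\<Sum>q\<in>I. \<beta> q) * (\<Sum>q\<in>I. norm (C k q))" if q: "q \<in> I" for k q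
  proof -
    have "norm (C (Suc k) q) \<le> \<beta> q * (\<Sum>q\<in>I. norm (C k q))"
    proof -
      obtain j b where jb: "q = (j, b)" by (cases q)
      consider "j = Suc N" | "j = 0" "b < n" | "j \<in> {1..N}" "b < n"
        using q jb by (force simp: I_def)
      then show ?thesis
      proof cases
        case 1
        then show ?thesis using \<beta>0[of q] by (simp add: C_def jb sum_nonneg)
      next
        case 2
        have "norm (C (Suc k) q) \<le> norm (act (A 0) (c k 0) b) + norm (act (B 0) (\<lambda>b. if k = 0 then u b else 0) b)"
          using 2 by (simp add: C_def jb coefficient_familyD(1)[OF c] norm_triangle_ineq)
        also have "\<dots> \<le> \<sigma> (A 0) b * (\<Sum>q\<in>I. norm (C k q)) + \<sigma> (B 0) b * (\<Sum>q\<in>I. norm (C k q))"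
          using agent[of 0 k] input[of k] A[of 0] B[of 0] by (intro add_mono act_le) auto
        finally show ?thesis using 2 by (simp add: \<beta>_def jb distrib_right)
      next
        case 3
        have "norm (C (Suc k) q) \<le> norm (act (F j) (c k j) b) + norm (act (Bs j) (c k (p j)) b)"
          using 3 by (simp add: C_def jb coefficient_familyD(2)[OF c] norm_triangle_ineq)
        also have "\<dots> \<le> \<sigma> (F j) b * (\<Sum>q\<in>I. norm (C k q)) + \<sigma> (Bs j) b * (\<Sum>q\<in>I. norm (C k q))"
          using agent[of j k] agent[OF p_le[OF 3(1)], of k] F_carrier[OF 3(1)] Bs_carrier[OF 3(1)] 3
          by (intro add_mono act_le) auto
        finally show ?thesis using 3 by (simp add: \<beta>_def jb distrib_right)
      qed
    qed
    also have "\<dots> \<le> (\<Sum>q\<in>I. \<beta> q) * (\<Sum>q\<in>I. norm (C k q))"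
      using \<beta>0 q fin by (intro mult_right_mono member_le_sum) (auto intro: sum_nonneg)
    finally show ?thesis .
  qed
  have "geometrically_bounded (\<lambda>k. C k (i, a))"
    by (rule geometrically_bounded_recurrence[where c = C, OF fin _ step])
      (use i a \<beta>0 in \<open>auto simp: I_def intro: sum_nonneg\<close>)
  then show ?thesis using i by (simp add: C_def)
qed

section \<open>Necessity of the Hurwitz conditions\<close>

lemma consensus_coefficient_family_real:
  fixes c :: "nat \<Rightarrow> nat \<Rightarrow> nat \<Rightarrow> real"
  assumes cons: "leader_following_consensus N n m A B G K W p"
    and c: "coefficient_family c u" and i: "i \<in> {1..N}" and a: "a < n"
  shows "((\<lambda>t. egf (\<lambda>k. c k i a - c k 0 a) t) \<longlongrightarrow> 0) at_top"
proof -
  define X where "X i a = egf (\<lambda>k. c k i a)" for i a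
  define x where "x i t = vec n (\<lambda>a. X i a t)" for i t
  note gb = geometrically_bounded_coefficient_family[OF c]
  have X: "(X i a has_real_derivative egf (\<lambda>k. c (Suc k) i a) t) (at t)" if "i \<le> N" "a < n" for i a t
    unfolding X_def has_real_derivative_iff_has_vector_derivative
    by (rule egf_has_vector_derivative[OF gb[OF that]])
  have act_X: "egf (\<lambda>k. act M (c k i) a) t = act M (\<lambda>b. X i b t) a" "geometrically_bounded (\<lambda>k. act M (c k i) a)"
    if "M \<in> carrier_mat n n" "i \<le> N" for M i a t
    unfolding X_def using gb that by (auto intro!: egf_act geometrically_bounded_act)
  have u0: "vec m u \<in> carrier_vec m" by simp
  \<comment> \<open>The recurrence for \<open>c\<close> is the closed-loop differential equation
    read coefficient by coefficient, so the series form a genuine trajectory.\<close>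
  have "closed_loop_trajectory N n m A B G K W p (vec m u) x
    (\<lambda>i t. if i = 0 then vec m u else - (G i *\<^sub>v x i t) + (K i * W i (p i)) *\<^sub>v (x (p i) t - x i t))"
    unfolding x_def
  proof (rule trajectoryI[OF u0])
    fix a t assume a: "a < n"
    have B0: "act (B 0) (\<lambda>b. if k = 0 then u b else 0) a = (if k = 0 then act (B 0) u a else 0)" for k :: nat
      by (simp add: act_zero)
    have "egf (\<lambda>k. c (Suc k) 0 a) t = act (A 0) (\<lambda>b. X 0 b t) a + act (B 0) u a"
      unfolding coefficient_familyD(1)[OF c a] B0
      using act_X[OF A, of 0 0] by (simp add: egf_add geometrically_bounded_initial egf_initial)
    moreover have "act (B 0) (($) (vec m u)) a = act (B 0) u a"
      by (rule act_cong) (use B[of 0] in auto)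
    ultimately show "(X 0 a has_real_derivative act (A 0) (\<lambda>b. X 0 b t) a + act (B 0) (($) (vec m u)) a) (at t)"
      using X[of 0 a t] a by simp
  next
    fix i a t assume i: "i \<in> {1..N}" and a: "a < n"
    have iN: "i \<le> N" using i by simp
    have "egf (\<lambda>k. c (Suc k) i a) t = act (F i) (\<lambda>b. X i b t) a + act (Bs i) (\<lambda>b. X (p i) b t) a"
      unfolding coefficient_familyD(2)[OF c a i]
      using act_X[OF F_carrier[OF i] iN] act_X[OF Bs_carrier[OF i] p_le[OF i]] by (simp add: egf_add)
    then show "(X i a has_real_derivative act (F i) (\<lambda>b. X i b t) a + act (Bs i) (\<lambda>b. X (p i) b t) a) (at t)"
      using X[OF iN a, of t] by simp
  qed
  then have "((\<lambda>t. vnorm (x i t - x 0 t)) \<longlongrightarrow> 0) at_top"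
    using cons u0 i unfolding leader_following_consensus_def by blast
  then have "((\<lambda>t. (x i t - x 0 t) $ a) \<longlongrightarrow> 0) at_top"
    using a by (subst (asm) vnorm_tendsto_zero_iff[of _ n]) (auto simp: x_def)
  then show ?thesis
    using a i by (simp add: x_def X_def egf_diff gb)
qed

text \<open>All matrices are real, so the real and imaginary parts of a family are again families.
  This admits complex eigenvectors as initial data.\<close>

lemma consensus_coefficient_family:
  fixes c :: "nat \<Rightarrow> nat \<Rightarrow> nat \<Rightarrow> complex"
  assumes cons: "leader_following_consensus N n m A B G K W p"
    and c: "coefficient_family c u" and i: "i \<in> {1..N}" and a: "a < n"
  shows "((\<lambda>t. egf (\<lambda>k. c k i a - c k 0 a) t) \<longlongrightarrow> 0) at_top"
proof -
  have gb: "geometrically_bounded (\<lambda>k. c k i a - c k 0 a)"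
    by (intro geometrically_bounded_diff geometrically_bounded_coefficient_family[OF c _ a])
      (use i in auto)
  have "coefficient_family (\<lambda>k i a. Re (c k i a)) (\<lambda>b. Re (u b))"
    using c by (auto simp: coefficient_family_def act_Re if_distrib[of Re] cong: if_cong)
  from consensus_coefficient_family_real[OF cons this i a]
  have "((\<lambda>t. Re (egf (\<lambda>k. c k i a - c k 0 a) t)) \<longlongrightarrow> 0) at_top"
    by (simp flip: egf_Re[OF gb])
  moreover have "coefficient_family (\<lambda>k i a. Im (c k i a)) (\<lambda>b. Im (u b))"
    using c by (auto simp: coefficient_family_def act_Im if_distrib[of Im] cong: if_cong)
  from consensus_coefficient_family_real[OF cons this i a]
  have "((\<lambda>t. Im (egf (\<lambda>k. c k i a - c k 0 a) t)) \<longlongrightarrow> 0) at_top"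
    by (simp flip: egf_Im[OF gb])
  ultimately show ?thesis by (simp add: tendsto_complex_iff)
qed

text \<open>Start agent \<open>i\<close> in an eigenvector and all others at 0, without input.
  Agents of smaller index, among them the leader and the parent of \<open>i\<close>, stay at rest,
  so agent \<open>i\<close> moves by \<open>F i\<close> alone and its error is
  \<open>exp (l t) v\<close>.\<close>

lemma hurwitz_follower_if_consensus:
  assumes cons: "leader_following_consensus N n m A B G K W p" and i: "i \<in> {1..N}"
  shows "hurwitz (F i)"
  unfolding hurwitz_def
proof (intro conjI allI impI)
  show "square_mat (F i)" unfolding square_mat.simps carrier_matD[OF F_carrier[OF i]] ..
  fix l assume "eigenvalue (map_mat complex_of_real (F i)) l"
  then obtain v a where v: "\<And>a. a < n \<Longrightarrow> act (F i) v a = l * v a" and a: "a < n" "v a \<noteq> 0"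
    using eigenvalue_act[OF F_carrier[OF i]] by metis
  obtain c where c0: "c 0 = (\<lambda>j a. if j = i then v a else 0)" and c: "coefficient_family c (\<lambda>_. 0)"
    by (rule coefficient_family_exists)
  have zero: "c k j b = 0" if "j < i" "b < n" for k j b
    using that
  proof (induction k arbitrary: j b)
    case (Suc k)
    have j: "j \<le> N" using Suc.prems(1) i by simp
    have z: "act M (c k j) b = 0" if "M \<in> carrier_mat n n" "j < i" for M j
      using act_cong[of M "c k j" "\<lambda>_. 0" b] Suc.IH that by (simp add: act_zero)
    show ?case
    proof (cases "j = 0")
      case True
      then show ?thesis
        using coefficient_familyD(1)[OF c Suc.prems(2)] z[OF A, of 0 0] Suc.prems(1) by (simp add: act_zero)
    next
      case False
      then have "j \<in> {1..N}" using j by simp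
      note j = this Suc.prems(1) less_trans[OF p[OF this] Suc.prems(1)]
      then show ?thesis
        using coefficient_familyD(2)[OF c Suc.prems(2) j(1)] z[OF F_carrier[OF j(1)] j(2)]
          z[OF Bs_carrier[OF j(1)] j(3)] by simp
    qed
  qed (use c0 in simp)
  have pow: "c k i b = v b * l ^ k" if "b < n" for k b
    using that
  proof (induction k arbitrary: b)
    case (Suc k)
    have "act (F i) (c k i) b = act (F i) (\<lambda>b. l ^ k * v b) b"
      by (rule act_cong) (use Suc.IH F_carrier[OF i] in auto)
    moreover have "act (Bs i) (c k (p i)) b = act (Bs i) (\<lambda>_. 0) b"
      by (rule act_cong) (use zero[OF p[OF i]] Bs_carrier[OF i] in auto)
    ultimately show ?case
      using coefficient_familyD(2)[OF c Suc.prems i] v[OF Suc.prems] by (simp add: act_cmult act_zero)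
  qed (use c0 in simp)
  have "c k i a - c k 0 a = v a * l ^ k" for k
    using pow[OF a(1)] zero[OF _ a(1), of 0] i by simp
  then have "((\<lambda>t. v a * exp (l * complex_of_real t)) \<longlongrightarrow> 0) at_top"
    using consensus_coefficient_family[OF cons c i a(1)] by (simp add: egf_power)
  \<comment> \<open>Taking the size of \<open>v a\<close> itself as tolerance gives
    \<open>exp (Re l * t) < 1\<close> at some positive time.\<close>
  from tendstoD[OF this, of "norm (v a)"]
  have "eventually (\<lambda>t. norm (v a) * exp (Re l * t) < norm (v a)) at_top"
    using a(2) by (simp add: norm_mult)
  then obtain t0 where "\<And>t. t0 \<le> t \<Longrightarrow> norm (v a) * exp (Re l * t) < norm (v a)"
    unfolding eventually_at_top_linorder by blast
  then obtain t :: real where t: "0 < t" "norm (v a) * exp (Re l * t) < norm (v a)"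
    using that[of "max t0 1"] by simp
  then have "exp (Re l * t) < 1" using a(2) by simp
  then show "Re l < 0" using t(1) by (simp add: mult_less_0_iff)
qed

text \<open>The increments all scale with \<open>l ^ k\<close>, hence so do their partial sums, the
  disturbances.\<close>

lemma disturbance_power:
  fixes v u :: "nat \<Rightarrow> nat \<Rightarrow> complex"
  assumes pow: "\<And>k r. r < N * n \<Longrightarrow> act Bb (stack (v k) (u k)) r = l ^ k * d r"
    and a: "a < n"
  shows "i \<in> {1..N} \<Longrightarrow> disturbance i (v k) (u k) a = l ^ k * disturbance i (v 0) (u 0) a"
proof (induction i)
  case (Suc j)
  then have j: "j < N" by simp
  note r = block_index_less[OF j a]
  have eq: "disturbance (Suc j) (v k) (u k) a = l ^ k * d (j * n + a)
      + (if j = 0 then 0 else disturbance j (v k) (u k) a)" for k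
    using act_Bb_stack[OF j a, of "v k" "u k"] pow[OF r, of k] by simp
  show ?case
    unfolding eq[of k] eq[of 0] using Suc.IH j by (auto simp: distrib_left)
qed simp

text \<open>Multiplying the error by \<open>exp (- l t)\<close> with \<open>Re l \<ge> 0\<close> keeps it small but turns the
  disturbance \<open>exp (l t) d\<close> into the constant \<open>d\<close>, which then has to vanish.\<close>

lemma exponential_disturbance_zero:
  fixes c :: "nat \<Rightarrow> nat \<Rightarrow> nat \<Rightarrow> complex"
  assumes cons: "leader_following_consensus N n m A B G K W p"
    and c: "coefficient_family c u" and l: "0 \<le> Re l" and i: "i \<in> {1..N}" and a: "a < n"
    and w: "\<And>k. disturbance i (c k 0) (\<lambda>b. if k = 0 then u b else 0) a = l ^ k * d"
  shows "d = 0"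
proof -
  define \<epsilon> where "\<epsilon> i b t = egf (\<lambda>k. c k i b - c k 0 b) t" for i b t
  have iN: "i \<le> N" using i by simp
  have gb: "geometrically_bounded (\<lambda>k. c k i b - c k 0 b)" if "i \<le> N" "b < n" for i b
    by (intro geometrically_bounded_diff geometrically_bounded_coefficient_family[OF c _ that(2)])
      (use that in auto)
  \<comment> \<open>Index 0 is included because the parent \<open>p i\<close> may be the
    leader.\<close>
  have \<epsilon>0: "(\<epsilon> i b \<longlongrightarrow> 0) at_top" if "i \<le> N" "b < n" for i b
  proof (cases "i = 0")
    case True
    then have "\<epsilon> i b = (\<lambda>_. 0)" by (simp add: fun_eq_iff \<epsilon>_def egf_def)
    then show ?thesis by simp
  next
    case False
    then show ?thesis
      unfolding \<epsilon>_def using consensus_coefficient_family[OF cons c _ that(2), of i] that by simp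
  qed
  let ?s = "\<lambda>t. act (F i) (\<lambda>b. \<epsilon> i b t) a + act (Bs i) (\<lambda>b. \<epsilon> (p i) b t) a"
  have coeff: "c (Suc k) i a - c (Suc k) 0 a = act (F i) (\<lambda>b. c k i b - c k 0 b) a
      + act (Bs i) (\<lambda>b. c k (p i) b - c k 0 b) a - d * l ^ k" for k
    unfolding coefficient_familyD(1)[OF c a] coefficient_familyD(2)[OF c a i]
    unfolding error_dynamics[OF i a] w by (simp add: mult.commute)
  have act_\<epsilon>: "egf (\<lambda>k. act M (\<lambda>b. c k j b - c k 0 b) a) t = act M (\<lambda>b. \<epsilon> j b t) a"
    "geometrically_bounded (\<lambda>k. act M (\<lambda>b. c k j b - c k 0 b) a)"
    if "M \<in> carrier_mat n n" "j \<le> N" for M j t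
    unfolding \<epsilon>_def using gb that by (auto intro!: egf_act geometrically_bounded_act)
  have \<epsilon>': "(\<epsilon> i a has_vector_derivative ?s t - d * exp (l * of_real t)) (at t)" for t
  proof -
    have "(\<epsilon> i a has_vector_derivative egf (\<lambda>k. c (Suc k) i a - c (Suc k) 0 a) t) (at t)"
      unfolding \<epsilon>_def by (rule egf_has_vector_derivative[OF gb[OF iN a]])
    also have "egf (\<lambda>k. c (Suc k) i a - c (Suc k) 0 a) t = ?s t - d * exp (l * of_real t)"
      unfolding coeff
      using act_\<epsilon>[OF F_carrier[OF i] iN] act_\<epsilon>[OF Bs_carrier[OF i] p_le[OF i]]
      by (simp add: egf_diff egf_add egf_power geometrically_bounded_add geometrically_bounded_power)
    finally show ?thesis .
  qed
  let ?E = "\<lambda>t::real. exp (- l * of_real t)"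
  have bounded_E: "((\<lambda>t. ?E t * f t) \<longlongrightarrow> 0) at_top" if f: "(f \<longlongrightarrow> 0) at_top" for f :: "real \<Rightarrow> complex"
  proof (rule tendsto_0_le[OF f, where K = 1])
    show "eventually (\<lambda>t. norm (?E t * f t) \<le> norm (f t) * 1) at_top"
      using eventually_ge_at_top[of 0]
    proof eventually_elim
      case (elim t)
      then have "norm (?E t) \<le> 1" using l by simp
      then show ?case unfolding norm_mult using mult_right_mono[of "norm (?E t)" 1 "norm (f t)"] by simp
    qed
  qed
  have "- d = 0"
  proof (rule derivative_limit_zero)
    show "((\<lambda>t. ?E t * \<epsilon> i a t) \<longlongrightarrow> 0) at_top" by (rule bounded_E[OF \<epsilon>0[OF iN a]])
    show "((\<lambda>t. ?E t * (?s t - l * \<epsilon> i a t) - d) \<longlongrightarrow> - d) at_top"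
    proof -
      have "(?s \<longlongrightarrow> 0) at_top"
        by (intro tendsto_add_zero tendsto_act_zero \<epsilon>0 iN p_le[OF i])
          (use F_carrier[OF i] Bs_carrier[OF i] in auto)
      then have "((\<lambda>t. ?s t - l * \<epsilon> i a t) \<longlongrightarrow> 0) at_top"
        using tendsto_diff[OF _ tendsto_mult_right_zero[OF \<epsilon>0[OF iN a], of l]] by fastforce
      from tendsto_diff[OF bounded_E[OF this] tendsto_const[of d]] show ?thesis by simp
    qed
    fix t :: real
    from has_vector_derivative_mult[OF exp_has_vector_derivative \<epsilon>', of "- l"]
    have "((\<lambda>t. ?E t * \<epsilon> i a t) has_vector_derivative
        ?E t * (?s t - d * exp (l * of_real t)) + ?E t * - l * \<epsilon> i a t) (at t)" .
    also have "?E t * (?s t - d * exp (l * of_real t)) + ?E t * - l * \<epsilon> i a t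
        = ?E t * (?s t - l * \<epsilon> i a t) - d * (?E t * exp (l * of_real t))"
      by (simp add: algebra_simps)
    also have "?E t * exp (l * of_real t) = 1" by (simp flip: exp_add)
    finally show "((\<lambda>t. ?E t * \<epsilon> i a t) has_vector_derivative ?E t * (?s t - l * \<epsilon> i a t) - d) (at t)"
      by simp
  qed
  then show ?thesis by simp
qed

text \<open>An eigenvector \<open>v\<close> of the quotient with \<open>Re l \<ge> 0\<close> is
  lifted by \<open>?R\<close> to a leader state and input. The resulting disturbances are
  exponential, so consensus forces them to vanish, and with them all outputs of the lifted vector
  under \<open>Bb * Db ^\<^sub>m j\<close>. The rows of \<open>L\<close> are among the rows of these
  products, so \<open>v\<close> would be 0.\<close>

lemma hurwitz_leader_if_consensus:
  assumes cs: "independent_columns (h_rank Bb Db) L cs"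
    and cons: "leader_following_consensus N n m A B G K W p"
  shows "hurwitz (L * Db * L3_mat L cs)"
proof -
  let ?h = "h_rank Bb Db"
  let ?R = "L3_mat L cs"
  let ?Q = "L * Db * ?R"
  have L: "L \<in> carrier_mat ?h (n + m)" by (rule L1_mat_properties(1)[OF Bb_carrier Db_carrier])
  have R: "?R \<in> carrier_mat (n + m) ?h" and LR: "L * ?R = 1\<^sub>m ?h" using L1_L3[OF L cs] by auto
  have LD: "L * Db \<in> carrier_mat ?h (n + m)" by (rule mult_carrier_mat[OF L Db_carrier])
  have Qc: "?Q \<in> carrier_mat ?h ?h" by (rule mult_carrier_mat[OF LD R])
  have BR: "Bb * ?R \<in> carrier_mat (N * n) ?h" by (rule mult_carrier_mat[OF Bb_carrier R])
  note quot = observability_quotient[OF Bb_carrier Db_carrier cs]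
  show ?thesis
    unfolding hurwitz_def
  proof (intro conjI allI impI)
    show "square_mat ?Q" unfolding square_mat.simps carrier_matD[OF Qc] ..
    fix l assume "eigenvalue (map_mat complex_of_real ?Q) l"
    then obtain v a0 where v: "\<And>a. a < ?h \<Longrightarrow> act ?Q v a = l * v a" and a0: "a0 < ?h" "v a0 \<noteq> 0"
      using eigenvalue_act[OF Qc] by metis
    show "Re l < 0"
    proof (rule ccontr)
      assume "\<not> Re l < 0"
      then have l: "0 \<le> Re l" by simp
      \<comment> \<open>The lifted vector is split: its first \<open>n\<close> coordinates are the
        leader's initial state, the remaining \<open>m\<close> its constant input.\<close>
      define u where "u b = act ?R v (n + b)" for b
      obtain c where c0: "c 0 = (\<lambda>j. act ?R v)" and c: "coefficient_family c u"
        by (rule coefficient_family_exists)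
      \<comment> \<open>The k-th derivative at 0 of the leader's state and input together; the input
        part is 0 for positive \<open>k\<close>.\<close>
      define \<zeta> where "\<zeta> k = stack (c k 0) (\<lambda>b. if k = 0 then u b else 0)" for k
      have \<zeta>0: "\<zeta> 0 = act ?R v" by (auto simp: \<zeta>_def c0 stack_def u_def)
      have \<zeta>_Suc: "\<zeta> (Suc k) b = act Db (\<zeta> k) b" if "b < n + m" for k b
        unfolding \<zeta>_def act_Db_stack[OF that] stack_def using coefficient_familyD(1)[OF c, of b k] by simp
      \<comment> \<open>It is the observed part of \<open>\<zeta> k\<close> that is a pure power;
        the lift itself need not be an eigenvector of \<open>Db\<close>.\<close>
      have L\<zeta>: "act L (\<zeta> k) a = l ^ k * v a" if "a < ?h" for k a
        using that
      proof (induction k arbitrary: a)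
        case 0
        have "act L (act ?R v) a = act (L * ?R) v a" by (rule act_mult[OF L R 0, symmetric])
        then show ?case unfolding \<zeta>0 LR using 0 by (simp add: act_one)
      next
        case (Suc k)
        have "act L (\<zeta> (Suc k)) a = act L (act Db (\<zeta> k)) a"
          by (rule act_cong) (use L \<zeta>_Suc in auto)
        also have "\<dots> = act (L * Db) (\<zeta> k) a" by (rule act_mult[OF L Db_carrier Suc.prems, symmetric])
        also have "\<dots> = act ?Q (act L (\<zeta> k)) a" by (subst quot(1)) (rule act_mult[OF Qc L Suc.prems])
        also have "\<dots> = act ?Q (\<lambda>b. l ^ k * v b) a"
          by (rule act_cong) (simp only: carrier_matD(2)[OF Qc] Suc.IH)
        also have "\<dots> = l ^ Suc k * v a" using v[OF Suc.prems] by (simp add: act_cmult)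
        finally show ?case .
      qed
      have B\<zeta>: "act Bb (\<zeta> k) r = l ^ k * act (Bb * ?R) v r" if r: "r < N * n" for k r
      proof -
        have "act Bb (\<zeta> k) r = act (Bb * ?R) (act L (\<zeta> k)) r"
          by (subst quot(2)) (rule act_mult[OF BR L r])
        also have "\<dots> = act (Bb * ?R) (\<lambda>b. l ^ k * v b) r"
          by (rule act_cong) (simp only: carrier_matD(2)[OF BR] L\<zeta>)
        finally show ?thesis by (simp add: act_cmult)
      qed
      have w0: "disturbance i (c 0 0) u a = 0" if i: "i \<in> {1..N}" and a: "a < n" for i a
        by (rule exponential_disturbance_zero[OF cons c l i a])
          (use disturbance_power[of "\<lambda>k. c k 0" "\<lambda>k b. if k = 0 then u b else 0", OF B\<zeta>[unfolded \<zeta>_def] a i]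
            in simp)
      \<comment> \<open>Zero initial disturbances make their increments at \<open>k = 0\<close>
        vanish; the scaling with \<open>l ^ k\<close> extends this to all \<open>k\<close>.\<close>
      have B0: "act Bb (\<zeta> k) r = 0" if r: "r < N * n" for k r
      proof -
        have n: "0 < n" using r by (cases n) auto
        then have j: "r div n < N" "r mod n < n" using r by (auto simp: less_mult_imp_div_less)
        have "act Bb (\<zeta> 0) (r div n * n + r mod n) = 0"
          unfolding \<zeta>_def act_Bb_stack[OF j] using w0 j by simp
        then have "act (Bb * ?R) v r = 0" using B\<zeta>[OF r, of 0] by simp
        then show ?thesis using B\<zeta>[OF r, of k] by simp
      qed
      have pow: "act (Db ^\<^sub>m j) (\<zeta> k) b = \<zeta> (k + j) b" if "b < n + m" for j k b
        using that
      proof (induction j arbitrary: k b)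
        case 0
        have "Db ^\<^sub>m 0 = 1\<^sub>m (n + m)" using Db_carrier by simp
        then show ?case using 0 by (simp add: act_one)
      next
        case (Suc j)
        have Dj: "Db ^\<^sub>m j \<in> carrier_mat (n + m) (n + m)" using Db_carrier by simp
        have "act (Db ^\<^sub>m Suc j) (\<zeta> k) b = act (Db ^\<^sub>m j) (act Db (\<zeta> k)) b"
          using act_mult[OF Dj Db_carrier Suc.prems] by simp
        also have "\<dots> = act (Db ^\<^sub>m j) (\<zeta> (Suc k)) b"
          by (rule act_cong) (use Dj \<zeta>_Suc in auto)
        finally show ?case using Suc.IH[OF Suc.prems] by simp
      qed
      \<comment> \<open>This is where observability enters: row \<open>a0\<close> of
        \<open>L\<close> was selected from some \<open>Bb * Db ^\<^sub>m j\<close>, so the nonzero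
        number \<open>v a0\<close> equals a coordinate of \<open>Bb\<close> applied to
        \<open>\<zeta> j\<close>, which is 0.\<close>
      have "row L a0 \<in> set (rows L)" using L a0(1) by (auto simp: rows_def)
      then obtain j where "row L a0 \<in> set (rows (Bb * Db ^\<^sub>m j))"
        using L1_mat_properties(3)[OF Bb_carrier Db_carrier] set_rows_V_mat[OF Bb_carrier Db_carrier]
        by blast
      then obtain r where r: "r < N * n" "row L a0 = row (Bb * Db ^\<^sub>m j) r"
        using Bb_carrier by (auto simp: rows_def)
      have Dj: "Db ^\<^sub>m j \<in> carrier_mat (n + m) (n + m)" using Db_carrier by simp
      have BD: "Bb * Db ^\<^sub>m j \<in> carrier_mat (N * n) (n + m)" by (rule mult_carrier_mat[OF Bb_carrier Dj])
      have "L $$ (a0, b) = (Bb * Db ^\<^sub>m j) $$ (r, b)" if "b < n + m" for b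
        using arg_cong[OF r(2), of "\<lambda>x. x $ b"] that L BD a0(1) r(1) by (simp del: index_mult_mat)
      then have "act L (\<zeta> 0) a0 = act (Bb * Db ^\<^sub>m j) (\<zeta> 0) r"
        unfolding act_def carrier_matD(2)[OF L] carrier_matD(2)[OF BD] by simp
      also have "\<dots> = act Bb (act (Db ^\<^sub>m j) (\<zeta> 0)) r" by (rule act_mult[OF Bb_carrier Dj r(1)])
      also have "\<dots> = act Bb (\<zeta> j) r"
        by (rule act_cong) (use Bb_carrier pow[of _ j 0] in auto)
      also have "\<dots> = 0" by (rule B0[OF r(1)])
      finally show False using L\<zeta>[OF a0(1), of 0] a0(2) by simp
    qed
  qed
qed

end

theorem theorem1:
  fixes N n m :: nat
    and A B G K :: "nat \<Rightarrow> real mat"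
    and W :: "nat \<Rightarrow> nat \<Rightarrow> real mat"
    and E T :: "(nat \<times> nat) set"
    and k :: "nat \<Rightarrow> nat"
    and cs :: "nat list"
  defines "Bb \<equiv> B_bar N n m A B G"
    and "Db \<equiv> D_bar n m A B"
  assumes "\<forall>i\<le>N. A i \<in> carrier_mat n n"
    and "\<forall>i\<le>N. B i \<in> carrier_mat n m"
    and "\<forall>i\<in>{1..N}. G i \<in> carrier_mat m n"
    and "\<forall>i\<in>{1..N}. K i \<in> carrier_mat m n"
    and "communication_graph N n E W"
    and "directed_spanning_tree N E T 0"
    and "\<forall>i\<in>{1..N}. (k i, i) \<in> T \<and> k i < i"
    and "independent_columns (h_rank Bb Db) (L1_mat Bb Db) cs"
  shows "leader_following_consensus N n m A B G K W k \<longleftrightarrow>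
    (\<forall>i\<in>{1..N}. hurwitz (A_star A B G i - B_star n B K W k i)) \<and>
    hurwitz (L1_mat Bb Db * Db * L3_mat (L1_mat Bb Db) cs)"
proof -
  interpret multi_agent_system N n m A B G K W k
    by unfold_locales (use assms in \<open>auto simp: communication_graph_def\<close>)
  note cs = assms(10)[unfolded Bb_def Db_def]
  show ?thesis
    unfolding Bb_def Db_def
    using consensus_if_hurwitz[OF cs] hurwitz_follower_if_consensus hurwitz_leader_if_consensus[OF cs]
    by blast
qed

end
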